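(* Suppose $Y_0=y_i$. Then $(\tilde Z^\Delta_s;\ s\ge0)$ converges in distribution, as $\Delta_t\to0$, to the process $\Big(\int_0^tR_s\,ds;\ t\ge0\Big)$, where $(R_s)_{s\ge 0}$ is a $\{y_1,\dots,y_k\}$-valued continuous-time Markov chain started at $y_i$ with the following dynamics: $(R_t)$ stays at level $y_j$ for an exponentially distributed time with mean $1/\big(\sum_{l=1}^kc(j,l)\big)$ and then jumps to $y_{j'}$ ($j'\ne j$) with probability $c(j,j')/\big(\sum_{l=1}^kc(j,l)\big)$.
   Context: Let $k\ge2$, let $y_1,\dots,y_k$ be $k$ (distinct) real numbers, and let $(c(i,j);\ 1\le i,j\le k)$ be a real matrix with $c(i,j)\ge0$ for $i\ne j$, $c(i,i)=0$, and $\sum_{l=1}^kc(i,l)>0$ for every $i$. For $\Delta_t>0$ small enough that $c(i,j)\Delta_t\le1$ and $\big(\sum_{l=1}^kc(i,l)\big)\Delta_t<1$ for all $i,j$, let $(Y_t)_{t\in\mathbb N}$ be the $\{y_1,\dots,y_k\}$-valued Markov chain with transition probabilities $$\pi^\Delta(y_i,y_j)=c(i,j)\Delta_t\ \ (i\ne j),\qquad \pi^\Delta(y_i,y_i)=1-\Big(\sum_{l=1}^kc(i,l)\Big)\Delta_t .$$ Set $X_t=\sum_{m=0}^tY_m$. With $\Delta_x=\Delta_t$, let $Z^\Delta_s=\Delta_tX_{s/\Delta_t}$ for $s\in\Delta_t\mathbb N$, and let $(\tilde Z^\Delta_s)_{s\ge0}$ be the linear interpolation of $(Z^\Delta_s)_{s\in\Delta_t\mathbb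 N}$. Convergence in distribution of processes means weak convergence of laws on the space of continuous functions on $[0,\infty)$ with the topology of uniform convergence on compact sets. *)

theory Defs
  imports "HOL-Probability.Probability"
begin

section \<open>Weak convergence on the space of continuous paths\<close>

definition path_space :: "(real \<Rightarrow> real) set" where
  "path_space = {f \<in> extensional {0..}. continuous_on {0..} f}"

definition ucc_open :: "(real \<Rightarrow> real) set \<Rightarrow> bool" where
  "ucc_open U \<longleftrightarrow> U \<subseteq> path_space \<and>
     (\<forall>f\<in>U. \<exists>K e. compact K \<and> K \<subseteq> {0..} \<and> e > 0 \<and>
        {g \<in> path_space. \<forall>t\<in>K. \<bar>g t - f t\<bar> < e} \<subseteq> U)"

definition ucc_topology :: "(real \<Rightarrow> real) topology" where
  "ucc_topology = topology ucc_open"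

lemma istopology_ucc_open: "istopology ucc_open"
  unfolding istopology_def
proof (intro conjI allI impI)
  fix U V
  assume U: "ucc_open U" and V: "ucc_open V"
  show "ucc_open (U \<inter> V)"
    unfolding ucc_open_def
  proof (intro conjI ballI)
    show "U \<inter> V \<subseteq> path_space"
      using U by (auto simp: ucc_open_def)
    fix f assume "f \<in> U \<inter> V"
    then have "f \<in> U" "f \<in> V" by auto
    obtain K e where
      K: "compact K" "K \<subseteq> {0..}" "e > 0"
        "{g \<in> path_space. \<forall>t\<in>K. \<bar>g t - f t\<bar> < e} \<subseteq> U"
      using U \<open>f \<in> U\<close> unfolding ucc_open_def by blast
    obtain L d where
      L: "compact L" "L \<subseteq> {0..}" "d > 0"
        "{g \<in> path_space. \<forall>t\<in>L. \<bar>g t - f t\<bar> < d} \<subseteq> V"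
      using V \<open>f \<in> V\<close> unfolding ucc_open_def by blast
    have "{g \<in> path_space. \<forall>t\<in>K \<union> L. \<bar>g t - f t\<bar> < min e d} \<subseteq> U \<inter> V"
      using K(4) L(4) by (auto simp: subset_iff)
    moreover have "compact (K \<union> L)" "K \<union> L \<subseteq> {0..}" "min e d > 0"
      using K L by auto
    ultimately show "\<exists>K e. compact K \<and> K \<subseteq> {0..} \<and> e > 0 \<and>
        {g \<in> path_space. \<forall>t\<in>K. \<bar>g t - f t\<bar> < e} \<subseteq> U \<inter> V"
      by blast
  qed
next
  fix \<K> :: "(real \<Rightarrow> real) set set"
  assume *: "\<forall>U\<in>\<K>. ucc_open U"
  show "ucc_open (\<Union>\<K>)"
    unfolding ucc_open_def
  proof (intro conjI ballI)
    show "\<Union>\<K> \<subseteq> path_space"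
      using * by (auto simp: ucc_open_def)
    fix f assume "f \<in> \<Union>\<K>"
    then obtain U where U: "U \<in> \<K>" "f \<in> U" by blast
    then have "ucc_open U" using * by blast
    then obtain K e where "compact K" "K \<subseteq> {0..}" "e > 0"
        "{g \<in> path_space. \<forall>t\<in>K. \<bar>g t - f t\<bar> < e} \<subseteq> U"
      using \<open>f \<in> U\<close> unfolding ucc_open_def by blast
    then show "\<exists>K e. compact K \<and> K \<subseteq> {0..} \<and> e > 0 \<and>
        {g \<in> path_space. \<forall>t\<in>K. \<bar>g t - f t\<bar> < e} \<subseteq> \<Union>\<K>"
      using U by (meson Union_upper order_trans)
  qed
qed

lemma openin_ucc_topology [simp]: "openin ucc_topology = ucc_open"
  unfolding ucc_topology_def by (rule topology_inverse' [OF istopology_ucc_open])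

lemma topspace_ucc_topology [simp]: "topspace ucc_topology = path_space"
proof -
  have "ucc_open path_space"
    unfolding ucc_open_def by (auto intro!: exI [of _ "{}"] exI [of _ 1])
  moreover have "U \<subseteq> path_space" if "ucc_open U" for U
    using that by (auto simp: ucc_open_def)
  ultimately show ?thesis
    unfolding topspace_def openin_ucc_topology by blast
qed

definition borel_of :: "'a topology \<Rightarrow> 'a measure" where
  "borel_of T = sigma (topspace T) {U. openin T U}"

definition weakly_converges ::
    "'a topology \<Rightarrow> ('i \<Rightarrow> 'a measure) \<Rightarrow> 'a measure \<Rightarrow> 'i filter \<Rightarrow> bool" where
  "weakly_converges T \<mu> \<nu> F \<longleftrightarrow>
     (\<forall>\<phi>. continuous_map T euclideanreal \<phi> \<and> bounded (\<phi> ` topspace T) \<longrightarrow>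
        ((\<lambda>i. \<integral>x. \<phi> x \<partial>\<mu> i) \<longlongrightarrow> (\<integral>x. \<phi> x \<partial>\<nu>)) F)"

definition path_of :: "(real \<Rightarrow> 'a \<Rightarrow> real) \<Rightarrow> 'a \<Rightarrow> real \<Rightarrow> real" where
  "path_of Z \<omega> = (\<lambda>t\<in>{0..}. Z t \<omega>)"

text \<open>
  The measurability clauses say that the paths are (eventually) random elements of the path
  space; without them the image measures would not be the laws of the processes.
\<close>

definition converges_in_distribution ::
    "('i \<Rightarrow> 'a measure) \<Rightarrow> ('i \<Rightarrow> real \<Rightarrow> 'a \<Rightarrow> real) \<Rightarrow>
     'b measure \<Rightarrow> (real \<Rightarrow> 'b \<Rightarrow> real) \<Rightarrow> 'i filter \<Rightarrow> bool" where
  "converges_in_distribution M Z N W F \<longleftrightarrow>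
     (\<forall>\<^sub>F i in F. path_of (Z i) \<in> measurable (M i) (borel_of ucc_topology)) \<and>
     path_of W \<in> measurable N (borel_of ucc_topology) \<and>
     weakly_converges ucc_topology
       (\<lambda>i. distr (M i) (borel_of ucc_topology) (path_of (Z i)))
       (distr N (borel_of ucc_topology) (path_of W)) F"


section \<open>The discrete chain and its rescaled partial sums\<close>

text \<open>
  Homogeneous Markov chain with state space \<open>e ` I\<close> started at \<open>e i\<close>;
  \<open>p a b\<close> is the probability of a transition from \<open>e a\<close> to \<open>e b\<close>.
\<close>

definition markov_chain ::
    "'a measure \<Rightarrow> 'i set \<Rightarrow> ('i \<Rightarrow> 's) \<Rightarrow> ('i \<Rightarrow> 'i \<Rightarrow> real) \<Rightarrow> 'i \<Rightarrow> (nat \<Rightarrow> 'a \<Rightarrow> 's) \<Rightarrow> bool" where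
  "markov_chain M I e p i Y \<longleftrightarrow>
     prob_space M \<and>
     (\<forall>n. Y n \<in> measurable M (count_space (e ` I))) \<and>
     (AE \<omega> in M. Y 0 \<omega> = e i) \<and>
     (\<forall>n a. a \<in> {..Suc n} \<rightarrow> I \<longrightarrow>
        \<P>(\<omega> in M. \<forall>m\<le>n. Y m \<omega> = e (a m)) > 0 \<longrightarrow>
        \<P>(\<omega> in M. Y (Suc n) \<omega> = e (a (Suc n)) \<bar> \<forall>m\<le>n. Y m \<omega> = e (a m)) = p (a n) (a (Suc n)))"

definition total_rate :: "nat \<Rightarrow> (nat \<Rightarrow> nat \<Rightarrow> real) \<Rightarrow> nat \<Rightarrow> real" where
  "total_rate k c i = (\<Sum>l=1..k. c i l)"

definition trans_prob :: "nat \<Rightarrow> (nat \<Rightarrow> nat \<Rightarrow> real) \<Rightarrow> real \<Rightarrow> nat \<Rightarrow> nat \<Rightarrow> real" where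
  "trans_prob k c \<Delta> i j = (if i = j then 1 - total_rate k c i * \<Delta> else c i j * \<Delta>)"

definition admissible_step :: "nat \<Rightarrow> (nat \<Rightarrow> nat \<Rightarrow> real) \<Rightarrow> real \<Rightarrow> bool" where
  "admissible_step k c \<Delta> \<longleftrightarrow> \<Delta> > 0 \<and>
     (\<forall>i\<in>{1..k}. \<forall>j\<in>{1..k}. c i j * \<Delta> \<le> 1) \<and>
     (\<forall>i\<in>{1..k}. total_rate k c i * \<Delta> < 1)"

definition partial_sum :: "(nat \<Rightarrow> 'a \<Rightarrow> real) \<Rightarrow> nat \<Rightarrow> 'a \<Rightarrow> real" where
  "partial_sum Y t \<omega> = (\<Sum>m\<le>t. Y m \<omega>)"

text \<open>
  The rescaled walk is only meaningful at grid points \<open>s = n * \<Delta>\<close>, where \<open>s / \<Delta>\<close> is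
  the natural number \<open>n\<close>; \<open>interpolate\<close> evaluates it at grid points only.
\<close>

definition rescaled :: "real \<Rightarrow> (nat \<Rightarrow> 'a \<Rightarrow> real) \<Rightarrow> real \<Rightarrow> 'a \<Rightarrow> real" where
  "rescaled \<Delta> Y s \<omega> = \<Delta> * partial_sum Y (nat \<lfloor>s / \<Delta>\<rfloor>) \<omega>"

definition interpolate :: "real \<Rightarrow> (real \<Rightarrow> 'a \<Rightarrow> real) \<Rightarrow> real \<Rightarrow> 'a \<Rightarrow> real" where
  "interpolate \<Delta> Z s \<omega> =
     (let n = \<lfloor>s / \<Delta>\<rfloor>; a = of_int n * \<Delta>; b = of_int (n + 1) * \<Delta>
      in ((b - s) * Z a \<omega> + (s - a) * Z b \<omega>) / \<Delta>)"


section \<open>The limiting continuous-time chain\<close>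

text \<open>
  \<open>R\<close> is a right-continuous process whose successive levels are \<open>y (J 0 \<omega>), y (J 1 \<omega>), ...\<close> with
  holding times \<open>S 0 \<omega>, S 1 \<omega>, ...\<close>.  The index process \<open>J\<close> is the embedded jump chain, and
  conditionally on \<open>J 0, ..., J n\<close> the holding times \<open>S 0, ..., S n\<close> are independent and
  exponential, \<open>S m\<close> having rate \<open>total_rate k c (J m)\<close>, i.e. mean \<open>1 / total_rate k c (J m)\<close>.
\<close>

definition continuous_time_chain ::
    "'a measure \<Rightarrow> nat \<Rightarrow> (nat \<Rightarrow> real) \<Rightarrow> (nat \<Rightarrow> nat \<Rightarrow> real) \<Rightarrow> nat \<Rightarrow> (real \<Rightarrow> 'a \<Rightarrow> real) \<Rightarrow> bool" where
  "continuous_time_chain M k y c i R \<longleftrightarrow>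
     prob_space M \<and>
     (\<forall>t\<ge>0. R t \<in> measurable M (count_space (y ` {1..k}))) \<and>
     (\<forall>\<omega>\<in>space M. \<forall>t\<ge>0. continuous (at_right t) (\<lambda>s. R s \<omega>)) \<and>
     (\<exists>J S.
        markov_chain M {1..k} (\<lambda>j. j) (\<lambda>j j'. c j j' / total_rate k c j) i J \<and>
        (\<forall>n. S n \<in> borel_measurable M) \<and>
        (\<forall>n a. a \<in> {..n} \<rightarrow> {1..k} \<longrightarrow>
           \<P>(\<omega> in M. \<forall>m\<le>n. J m \<omega> = a m) > 0 \<longrightarrow>
           (let P = uniform_measure M {\<omega> \<in> space M. \<forall>m\<le>n. J m \<omega> = a m}
            in prob_space.indep_vars P (\<lambda>_. borel) S {..n} \<and>
               (\<forall>m\<le>n. distributed P lborel (S m)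
                  (\<lambda>x. ennreal (exponential_density (total_rate k c (a m)) x))))) \<and>
        (AE \<omega> in M. \<forall>n t. 0 \<le> t \<and> (\<Sum>m<n. S m \<omega>) \<le> t \<and> t < (\<Sum>m<Suc n. S m \<omega>) \<longrightarrow>
           R t \<omega> = y (J n \<omega>)))"

end

theory Submission
  imports Defs
begin

text \<open>
  The limit process is built from a jump chain \<open>J\<close> and exponential holding times \<open>S\<close>, and a discrete
  chain with step \<open>\<Delta>\<close> can be built from the very same \<open>J\<close> and \<open>S\<close>.  An exponential variable of rate
  \<open>\<lambda>\<close>, measured in units of \<open>h = - ln (1 - \<lambda> \<Delta>) / \<lambda>\<close> and rounded up, is geometric with success
  probability \<open>\<lambda> \<Delta>\<close>; so the sequence that stays at \<open>J 0\<close> for the rounded number of steps, then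
  moves to \<open>J 1\<close>, and so on, is a Markov chain with the transition matrix \<open>trans_prob k c \<Delta>\<close>
  (\<open>coupled_chain_path_prob\<close>).  Finite-dimensional laws determine the law of a sequence, so \<open>Y \<Delta>\<close>
  has the same law as this coupled chain (\<open>distr_eq_of_path_probs\<close>), and the expectation of a
  functional of the rescaled walk may be computed on the probability space of \<open>R\<close>.

  On that space the convergence is almost sure.  Since \<open>h / \<Delta>\<close> tends to \<open>1\<close>, the rescaled rounded
  holding times converge to \<open>S\<close>; the rates are bounded, so the jump times exhaust the half-line
  (\<open>AE_no_explosion\<close>); hence for every time \<open>u\<close> that is not a jump time the coupled chain near \<open>u\<close>
  eventually occupies the level \<open>R u\<close> (\<open>AE_coupled_chain_tendsto\<close>).  The interpolated walk is up to a
  term of order \<open>\<Delta>\<close> the integral of the chain read as a step function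
  (\<open>grid_path_has_integral\<close>), so dominated convergence turns this into locally uniform convergence of
  the paths (\<open>grid_paths_converge_to_integral\<close>).  A second use of dominated convergence gives the
  convergence of the expectations of bounded continuous functionals, without any tightness argument.

  Measurability of the limit path comes from the same convergence result: by right-continuity the
  path is a pointwise limit of polygonal paths that depend on countably many values of \<open>R\<close>.
\<close>

section \<open>Continuous paths under locally uniform convergence\<close>

lemma path_spaceI:
  assumes "f \<in> extensional {0..}" "\<And>T. T > 0 \<Longrightarrow> continuous_on {0..T} f"
  shows "f \<in> path_space"
proof -
  have "continuous (at t within {0..}) f" if "t \<ge> 0" for t
  proof -
    have "continuous (at t within {0..t+1}) f"
      using assms(2)[of "t+1"] that by (simp add: continuous_on_eq_continuous_within)
    moreover have "at t within {0..t+1} = at t within {0..}"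
      by (rule at_within_nhd[where S = "{t-1<..<t+1}"]) auto
    ultimately show ?thesis by simp
  qed
  then show ?thesis
    using assms(1) by (auto simp: path_space_def continuous_on_eq_continuous_within)
qed

lemma limitin_uccI:
  assumes "\<And>j. f j \<in> path_space" "g \<in> path_space"
    and lim: "\<And>T. T \<ge> 0 \<Longrightarrow> (b T \<longlongrightarrow> 0) F"
    and bound: "\<And>j T t. 0 \<le> t \<Longrightarrow> t \<le> T \<Longrightarrow> \<bar>f j t - g t\<bar> \<le> b T j"
  shows "limitin ucc_topology f g F"
  unfolding limitin_def openin_ucc_topology topspace_ucc_topology
proof (intro conjI allI impI)
  fix U assume "ucc_open U \<and> g \<in> U"
  then obtain K e where K: "compact K" "K \<subseteq> {0..}" "e > 0"
    and sub: "{h \<in> path_space. \<forall>t\<in>K. \<bar>h t - g t\<bar> < e} \<subseteq> U"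
    unfolding ucc_open_def by blast
  obtain T where T: "T \<ge> 0" "K \<subseteq> {0..T}"
    using compact_imp_bounded[OF \<open>compact K\<close>] K(2) unfolding bounded_iff
    by (metis abs_ge_zero abs_le_D1 atLeastAtMost_iff atLeast_iff order_trans real_norm_def subsetD
        subsetI linear)
  have "\<forall>\<^sub>F j in F. b T j < e"
    using order_tendstoD(2)[OF lim[OF T(1)] K(3)] .
  then show "\<forall>\<^sub>F j in F. f j \<in> U"
  proof eventually_elim
    case (elim j)
    have "\<bar>f j t - g t\<bar> < e" if "t \<in> K" for t
      using bound[of t T j] elim T(2) that by force
    then show ?case using sub assms(1) by blast
  qed
qed (fact assms(2))

lemma space_borel_of_ucc [simp]: "space (borel_of ucc_topology) = path_space"
  unfolding borel_of_def by (subst space_measure_of) (auto simp: ucc_open_def)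

lemma measurable_uccI:
  assumes "\<And>\<omega>. \<omega> \<in> space M \<Longrightarrow> f \<omega> \<in> path_space"
    and "\<And>U. ucc_open U \<Longrightarrow> f -` U \<inter> space M \<in> sets M"
  shows "f \<in> measurable M (borel_of ucc_topology)"
  unfolding borel_of_def
  by (rule measurable_measure_of) (use assms in \<open>auto simp: ucc_open_def\<close>)

lemma ucc_open_vimage:
  assumes "f \<in> measurable M (borel_of ucc_topology)" "ucc_open U"
  shows "f -` U \<inter> space M \<in> sets M"
proof (rule measurable_sets[OF assms(1)])
  show "U \<in> sets (borel_of ucc_topology)"
    unfolding borel_of_def
    by (subst sets_measure_of) (use assms in \<open>auto simp: ucc_open_def\<close>)
qed

lemma ucc_continuous_measurable:
  assumes "continuous_map ucc_topology euclideanreal \<phi>"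
  shows "\<phi> \<in> borel_measurable (borel_of ucc_topology)"
proof (rule borel_measurableI)
  fix S :: "real set" assume "open S"
  then have "ucc_open {f \<in> path_space. \<phi> f \<in> S}"
    using assms by (auto simp: continuous_map_def)
  moreover have "\<phi> -` S \<inter> space (borel_of ucc_topology) = {f \<in> path_space. \<phi> f \<in> S}" by auto
  ultimately show "\<phi> -` S \<inter> space (borel_of ucc_topology) \<in> sets (borel_of ucc_topology)"
    unfolding borel_of_def
    by (subst sets_measure_of) (auto simp: ucc_open_def)
qed

text \<open>
  The paths that lie in \<open>U\<close> together with a ball of radius more than \<open>q\<close> for the uniform distance on
  \<open>[0, T]\<close>.  These sets replace the sets of points at distance more than \<open>q\<close> from the complement of
  \<open>U\<close>, so that the usual argument for limits of measurable maps into a metric space applies without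
  a metric for locally uniform convergence.
\<close>

definition ucc_inner :: "(real \<Rightarrow> real) set \<Rightarrow> real \<Rightarrow> real \<Rightarrow> (real \<Rightarrow> real) set" where
  "ucc_inner U T q = {f \<in> path_space. \<exists>e>q.
     {g \<in> path_space. \<forall>t\<in>{0..T}. \<bar>g t - f t\<bar> < e} \<subseteq> U}"

lemma ucc_open_inner: "ucc_open (ucc_inner U T q)"
  unfolding ucc_open_def
proof (intro conjI ballI)
  fix f assume "f \<in> ucc_inner U T q"
  then obtain e where f: "f \<in> path_space" and e: "e > q"
    and sub: "{g \<in> path_space. \<forall>t\<in>{0..T}. \<bar>g t - f t\<bar> < e} \<subseteq> U"
    unfolding ucc_inner_def by blast
  define d where "d = (e - q) / 2"
  have d: "d > 0" using e by (simp add: d_def)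
  have ed: "e - d > q" using e by (simp add: d_def field_simps)
  have "{g \<in> path_space. \<forall>t\<in>{0..T}. \<bar>g t - f t\<bar> < d} \<subseteq> ucc_inner U T q"
  proof safe
    fix g assume g: "g \<in> path_space" "\<forall>t\<in>{0..T}. \<bar>g t - f t\<bar> < d"
    have "{h \<in> path_space. \<forall>t\<in>{0..T}. \<bar>h t - g t\<bar> < e - d} \<subseteq> U"
    proof safe
      fix h assume h: "h \<in> path_space" "\<forall>t\<in>{0..T}. \<bar>h t - g t\<bar> < e - d"
      have "\<bar>h t - f t\<bar> < e" if "t \<in> {0..T}" for t
        using g(2)[rule_format, OF that] h(2)[rule_format, OF that] by linarith
      then show "h \<in> U" using sub h(1) by blast
    qed
    then show "g \<in> ucc_inner U T q"
      unfolding ucc_inner_def using g(1) ed by blast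
  qed
  then show "\<exists>K e. compact K \<and> K \<subseteq> {0..} \<and> 0 < e \<and>
      {g \<in> path_space. \<forall>t\<in>K. \<bar>g t - f t\<bar> < e} \<subseteq> ucc_inner U T q"
    using d by (intro exI[of _ "{0..T}"] exI[of _ d]) auto
qed (auto simp: ucc_inner_def)

lemma ucc_inner_exhausts:
  assumes "ucc_open U" "f \<in> U"
  obtains n where "f \<in> ucc_inner U (real n) (inverse (real (Suc n)))"
proof -
  obtain K e where K: "compact K" "K \<subseteq> {0..}" "e > 0"
    and sub: "{h \<in> path_space. \<forall>t\<in>K. \<bar>h t - f t\<bar> < e} \<subseteq> U"
    using assms unfolding ucc_open_def by blast
  obtain T where T: "\<And>t. t \<in> K \<Longrightarrow> \<bar>t\<bar> \<le> T"
    using compact_imp_bounded[OF \<open>compact K\<close>] unfolding bounded_iff by auto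
  obtain n1 where n1: "T \<le> real n1" using real_arch_simple by blast
  obtain n2 where n2: "inverse (real (Suc n2)) < e" using K(3) reals_Archimedean by blast
  define n where "n = max n1 n2"
  have "inverse (real (Suc n)) \<le> inverse (real (Suc n2))"
    by (auto simp: n_def intro!: le_imp_inverse_le)
  then have "inverse (real (Suc n)) < e" using n2 by linarith
  moreover have "K \<subseteq> {0..real n}"
    using K(2) T n1 unfolding n_def by fastforce
  then have "{h \<in> path_space. \<forall>t\<in>{0..real n}. \<bar>h t - f t\<bar> < e} \<subseteq> U"
    using sub by blast
  ultimately have "f \<in> ucc_inner U (real n) (inverse (real (Suc n)))"
    using assms unfolding ucc_inner_def ucc_open_def by blast
  then show ?thesis by (rule that)
qed

text \<open>
  A limit path lies in an open set \<open>U\<close> iff, for some margin, the approximating paths eventually lie in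
  \<open>U\<close> with that margin; this expresses the preimage of \<open>U\<close> by countably many measurable sets.  In this
  way the Borel sets of the path space are handled without proving that the space is separable.
\<close>

lemma measurable_ucc_limit:
  assumes meas: "\<And>j. f j \<in> measurable M (borel_of ucc_topology)"
    and lim: "\<And>\<omega>. \<omega> \<in> space M \<Longrightarrow> limitin ucc_topology (\<lambda>j. f j \<omega>) (g \<omega>) sequentially"
  shows "g \<in> measurable M (borel_of ucc_topology)"
proof (rule measurable_uccI)
  show g: "g \<omega> \<in> path_space" if "\<omega> \<in> space M" for \<omega>
    using lim[OF that] by (auto simp: limitin_def)
  fix U assume U: "ucc_open U"
  have "g -` U \<inter> space M =
      (\<Union>n. \<Union>m. \<Inter>j\<in>{m..}. f j -` ucc_inner U (real n) (inverse (real (Suc n))) \<inter> space M)" (is "_ = ?R")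
  proof (intro equalityI subsetI)
    fix \<omega> assume \<omega>: "\<omega> \<in> g -` U \<inter> space M"
    obtain n where "g \<omega> \<in> ucc_inner U (real n) (inverse (real (Suc n)))"
      using ucc_inner_exhausts[OF U] \<omega> by blast
    then have "\<forall>\<^sub>F j in sequentially. f j \<omega> \<in> ucc_inner U (real n) (inverse (real (Suc n)))"
      using lim[of \<omega>] \<omega> ucc_open_inner unfolding limitin_def openin_ucc_topology by blast
    then show "\<omega> \<in> ?R" using \<omega> unfolding eventually_sequentially by auto
  next
    fix \<omega> assume "\<omega> \<in> ?R"
    then obtain n m where m: "\<And>j. j \<ge> m \<Longrightarrow> f j \<omega> \<in> ucc_inner U (real n) (inverse (real (Suc n)))"
      and \<omega>: "\<omega> \<in> space M"
      by auto
    define q where "q = inverse (real (Suc n))"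
    have "q > 0" by (simp add: q_def)
    \<comment> \<open>The open ball around the limit whose radius is the margin, in the form of a strict bound on the supremum.\<close>
    define B where "B = {h \<in> path_space. \<exists>e<q.
      \<forall>t\<in>{0..real n}. \<bar>h t - g \<omega> t\<bar> < e}"
    have "ucc_open B"
      unfolding ucc_open_def
    proof (intro conjI ballI)
      fix h assume "h \<in> B"
      then obtain e where e: "e < q"
        and he: "\<And>t. t \<in> {0..real n} \<Longrightarrow> \<bar>h t - g \<omega> t\<bar> < e" unfolding B_def by blast
      define d where "d = (q - e) / 2"
      have d: "d > 0" using e by (simp add: d_def)
      have ed: "e + d < q" using e by (simp add: d_def field_simps)
      have "{h' \<in> path_space. \<forall>t\<in>{0..real n}. \<bar>h' t - h t\<bar> < d} \<subseteq> B"
      proof safe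
        fix h' assume h': "h' \<in> path_space" "\<forall>t\<in>{0..real n}. \<bar>h' t - h t\<bar> < d"
        have "\<bar>h' t - g \<omega> t\<bar> < e + d" if "t \<in> {0..real n}" for t
          using he[OF that] h'(2)[rule_format, OF that] by linarith
        then show "h' \<in> B" unfolding B_def using h'(1) ed by blast
      qed
      then show "\<exists>K e. compact K \<and> K \<subseteq> {0..} \<and> 0 < e \<and>
          {g \<in> path_space. \<forall>t\<in>K. \<bar>g t - h t\<bar> < e} \<subseteq> B"
        using d by (intro exI[of _ "{0..real n}"] exI[of _ d]) auto
    qed (auto simp: B_def)
    moreover have "g \<omega> \<in> B"
      unfolding B_def using g[OF \<omega>]
      by (auto simp: \<open>q > 0\<close> intro!: exI[of _ "q / 2"])
    ultimately have "\<forall>\<^sub>F j in sequentially. f j \<omega> \<in> B"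
      using lim[OF \<omega>] unfolding limitin_def openin_ucc_topology by blast
    then obtain j where j: "j \<ge> m" "f j \<omega> \<in> B"
      unfolding eventually_sequentially by (metis linear)
    obtain e where e: "e > q"
      and sub: "{h \<in> path_space. \<forall>t\<in>{0..real n}. \<bar>h t - f j \<omega> t\<bar> < e} \<subseteq> U"
      using m[OF j(1)] unfolding ucc_inner_def q_def by blast
    have "\<bar>g \<omega> t - f j \<omega> t\<bar> < e" if "t \<in> {0..real n}" for t
      using j(2) that e unfolding B_def by (fastforce simp: abs_minus_commute)
    then show "\<omega> \<in> g -` U \<inter> space M" using sub g[OF \<omega>] \<omega> by blast
  qed
  also have "\<dots> \<in> sets M"
  proof (intro sets.countable_UN'' countableI_type)
    show "(\<Inter>j\<in>{m..}. f j -` ucc_inner U (real n) (inverse (real (Suc n))) \<inter> space M) \<in> sets M" for n m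
      using ucc_open_vimage[OF meas ucc_open_inner] by (intro sets.countable_INT') auto
  qed
  finally show "g -` U \<inter> space M \<in> sets M" .
qed

section \<open>Polygonal paths as integrals of step functions\<close>

text \<open>
  The interpolated walk as a function of the sequence of its increments, so that it can be evaluated
  on increments from any probability space.
\<close>

definition grid_path :: "real \<Rightarrow> (nat \<Rightarrow> real) \<Rightarrow> real \<Rightarrow> real" where
  "grid_path \<Delta> x = path_of (interpolate \<Delta> (rescaled \<Delta> (\<lambda>n x. x n))) x"

lemma path_of_interpolate:
  "path_of (interpolate \<Delta> (rescaled \<Delta> Y)) \<omega> = grid_path \<Delta> (\<lambda>n. Y n \<omega>)"
  by (simp add: grid_path_def path_of_def interpolate_def rescaled_def partial_sum_def Let_def)

lemma grid_path_eq:
  assumes "\<Delta> > 0" "s \<ge> 0"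
  defines "n \<equiv> nat \<lfloor>s / \<Delta>\<rfloor>"
  shows "grid_path \<Delta> x s = \<Delta> * (\<Sum>m\<le>n. x m) + (s - real n * \<Delta>) * x (Suc n)"
proof -
  have n: "\<lfloor>s / \<Delta>\<rfloor> = int n"
    using assms by simp
  have Z: "rescaled \<Delta> (\<lambda>n x. x n) (real m * \<Delta>) x = \<Delta> * (\<Sum>l\<le>m. x l)" for m
    using assms by (simp add: rescaled_def partial_sum_def)
  have "grid_path \<Delta> x s = (((1 + real n) * \<Delta> - s) * (\<Delta> * (\<Sum>l\<le>n. x l))
      + (s - real n * \<Delta>) * (\<Delta> * (\<Sum>l\<le>Suc n. x l))) / \<Delta>"
    using assms Z[of n] Z[of "Suc n"]
    by (simp add: grid_path_def path_of_def interpolate_def Let_def n add.commute del: sum.atMost_Suc)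
  also have "\<dots> = \<Delta> * (\<Sum>m\<le>n. x m) + (s - real n * \<Delta>) * x (Suc n)"
    using assms by (simp add: field_simps)
  finally show ?thesis .
qed

lemma grid_position:
  assumes "\<Delta> > 0" "s \<ge> 0"
  shows "real (nat \<lfloor>s / \<Delta>\<rfloor>) * \<Delta> \<le> s" "s \<le> (real (nat \<lfloor>s / \<Delta>\<rfloor>) + 1) * \<Delta>"
proof -
  have "real (nat \<lfloor>s / \<Delta>\<rfloor>) = of_int \<lfloor>s / \<Delta>\<rfloor>" using assms by simp
  then show "real (nat \<lfloor>s / \<Delta>\<rfloor>) * \<Delta> \<le> s" "s \<le> (real (nat \<lfloor>s / \<Delta>\<rfloor>) + 1) * \<Delta>"
    using assms by (auto simp: pos_le_divide_eq[symmetric] pos_divide_le_eq[symmetric])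
qed

lemma grid_path_diff_le:
  assumes "\<Delta> > 0" "0 \<le> s" "s \<le> T"
  shows "\<bar>grid_path \<Delta> x s - grid_path \<Delta> x' s\<bar> \<le> \<Delta> * (\<Sum>m\<le>Suc (nat \<lfloor>T / \<Delta>\<rfloor>). \<bar>x m - x' m\<bar>)"
proof -
  define n where "n = nat \<lfloor>s / \<Delta>\<rfloor>"
  have "s / \<Delta> \<le> T / \<Delta>" using assms by (simp add: divide_right_mono)
  then have nT: "Suc n \<le> Suc (nat \<lfloor>T / \<Delta>\<rfloor>)"
    unfolding n_def by (auto intro: nat_mono floor_mono)
  have pos: "0 \<le> s - real n * \<Delta>" "s - real n * \<Delta> \<le> \<Delta>"
    using grid_position[of \<Delta> s] assms by (auto simp: n_def algebra_simps)
  have "grid_path \<Delta> x s - grid_path \<Delta> x' s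
      = \<Delta> * (\<Sum>m\<le>n. x m - x' m) + (s - real n * \<Delta>) * (x (Suc n) - x' (Suc n))"
    using assms by (simp add: grid_path_eq n_def sum_subtractf algebra_simps)
  also have "\<bar>\<dots>\<bar> \<le> \<bar>\<Delta> * (\<Sum>m\<le>n. x m - x' m)\<bar> + \<bar>(s - real n * \<Delta>) * (x (Suc n) - x' (Suc n))\<bar>"
    by (rule abs_triangle_ineq)
  also have "\<dots> \<le> \<Delta> * (\<Sum>m\<le>n. \<bar>x m - x' m\<bar>) + \<Delta> * \<bar>x (Suc n) - x' (Suc n)\<bar>"
    using assms pos by (auto simp: abs_mult intro!: add_mono mult_mono sum_abs)
  also have "\<dots> = \<Delta> * (\<Sum>m\<le>Suc n. \<bar>x m - x' m\<bar>)" by (simp add: algebra_simps)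
  also have "\<dots> \<le> \<Delta> * (\<Sum>m\<le>Suc (nat \<lfloor>T / \<Delta>\<rfloor>). \<bar>x m - x' m\<bar>)"
    using assms nT by (intro mult_left_mono sum_mono2) auto
  finally show ?thesis .
qed

text \<open>
  Between two grid points the interpolated walk has slope equal to the next increment, because both
  axes are scaled by \<open>\<Delta>\<close>.  The term \<open>\<Delta> * x 0\<close> appears since the walk starts with its first increment
  instead of \<open>0\<close>.
\<close>

lemma grid_path_has_integral:
  assumes "\<Delta> > 0" "s \<ge> 0"
  shows "((\<lambda>u. x (Suc (nat \<lfloor>u / \<Delta>\<rfloor>))) has_integral grid_path \<Delta> x s - \<Delta> * x 0) {0..s}"
proof -
  let ?f = "\<lambda>u. x (Suc (nat \<lfloor>u / \<Delta>\<rfloor>))"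
  have piece: "(?f has_integral (t - real n * \<Delta>) * x (Suc n)) {real n * \<Delta>..t}"
    if "real n * \<Delta> \<le> t" "t \<le> real (Suc n) * \<Delta>" for n t
  proof -
    have "((\<lambda>u. x (Suc n)) has_integral (t - real n * \<Delta>) * x (Suc n)) (cbox (real n * \<Delta>) t)"
      using has_integral_const_real[of "x (Suc n)" "real n * \<Delta>" t] that by simp
    moreover have "?f u = x (Suc n)" if u: "u \<in> box (real n * \<Delta>) t" for u
    proof -
      have "real n \<le> u / \<Delta>" "u / \<Delta> < real n + 1"
        using u that \<open>t \<le> _\<close> assms by (auto simp: field_simps)
      then have "\<lfloor>u / \<Delta>\<rfloor> = int n" by (simp add: floor_eq_iff)
      then show ?thesis by simp
    qed
    ultimately have "(?f has_integral (t - real n * \<Delta>) * x (Suc n)) (cbox (real n * \<Delta>) t)"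
      by (rule has_integral_spike_interior)
    then show ?thesis by simp
  qed
  have steps: "(?f has_integral \<Delta> * (\<Sum>m<n. x (Suc m))) {0..real n * \<Delta>}" for n
  proof (induction n)
    case (Suc n)
    have "(?f has_integral \<Delta> * (\<Sum>m<n. x (Suc m)) + (real (Suc n) * \<Delta> - real n * \<Delta>) * x (Suc n))
        {0..real (Suc n) * \<Delta>}"
      using assms(1) by (intro has_integral_combine[OF _ _ Suc piece]) (auto simp: algebra_simps)
    then show ?case by (simp add: algebra_simps)
  qed (simp add: has_integral_refl)
  define n where "n = nat \<lfloor>s / \<Delta>\<rfloor>"
  have "(?f has_integral \<Delta> * (\<Sum>m<n. x (Suc m)) + (s - real n * \<Delta>) * x (Suc n)) {0..s}"
    using assms grid_position[of \<Delta> s]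
    by (intro has_integral_combine[OF _ _ steps piece]) (auto simp: n_def algebra_simps)
  moreover have "grid_path \<Delta> x s - \<Delta> * x 0
      = \<Delta> * (\<Sum>m<n. x (Suc m)) + (s - real n * \<Delta>) * x (Suc n)"
    using assms sum.atMost_shift[of x n] by (simp add: grid_path_eq n_def algebra_simps)
  ultimately show ?thesis by simp
qed

lemma grid_path_in_path_space:
  assumes "\<Delta> > 0"
  shows "grid_path \<Delta> x \<in> path_space"
proof (rule path_spaceI)
  show "grid_path \<Delta> x \<in> extensional {0..}" by (simp add: grid_path_def path_of_def)
  fix T :: real assume "T > 0"
  let ?f = "\<lambda>u. x (Suc (nat \<lfloor>u / \<Delta>\<rfloor>))"
  have "continuous_on {0..T} (\<lambda>s. integral {0..s} ?f + \<Delta> * x 0)"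
    using grid_path_has_integral[OF assms, where x = x and s = T] \<open>T > 0\<close>
    by (intro continuous_intros indefinite_integral_continuous_1) (auto intro: has_integral_integrable)
  moreover have "integral {0..s} ?f + \<Delta> * x 0 = grid_path \<Delta> x s" if "s \<in> {0..T}" for s
    using integral_unique[OF grid_path_has_integral[OF assms, where x = x and s = s]] that by simp
  ultimately show "continuous_on {0..T} (grid_path \<Delta> x)"
    by (rule continuous_on_eq)
qed

text \<open>
  The path on a compact time interval depends linearly on finitely many increments
  (\<open>grid_path_diff_le\<close>), hence continuously on the whole sequence in the product topology, and the Borel
  sets of that topology are those of the product measure space.
\<close>

lemma measurable_grid_path:
  assumes "\<Delta> > 0"
  shows "grid_path \<Delta> \<in> measurable (PiM UNIV (\<lambda>_. borel)) (borel_of ucc_topology)"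
proof -
  have "grid_path \<Delta> \<in> measurable (borel :: (nat \<Rightarrow> real) measure) (borel_of ucc_topology)"
  proof (rule measurable_uccI)
    show "grid_path \<Delta> x \<in> path_space" for x by (rule grid_path_in_path_space[OF assms])
    fix U assume U: "ucc_open U"
    have "open (grid_path \<Delta> -` U)"
    proof (subst open_subopen, rule ballI)
      fix x assume "x \<in> grid_path \<Delta> -` U"
      then obtain K e where K: "compact K" "K \<subseteq> {0..}" "e > 0"
        and sub: "{h \<in> path_space. \<forall>t\<in>K. \<bar>h t - grid_path \<Delta> x t\<bar> < e} \<subseteq> U"
        using U unfolding ucc_open_def by blast
      obtain T where T: "\<And>t. t \<in> K \<Longrightarrow> \<bar>t\<bar> \<le> T"
        using compact_imp_bounded[OF \<open>compact K\<close>] unfolding bounded_iff by auto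
      define V where "V = {x'. \<Delta> * (\<Sum>m\<le>Suc (nat \<lfloor>T / \<Delta>\<rfloor>). \<bar>x' m - x m\<bar>) < e}"
      have "open V" unfolding V_def
        by (intro open_Collect_less continuous_intros continuous_on_product_coordinates)
      moreover have "x \<in> V" using K(3) by (simp add: V_def)
      moreover have "V \<subseteq> grid_path \<Delta> -` U"
      proof
        fix x' assume "x' \<in> V"
        then have "\<bar>grid_path \<Delta> x' t - grid_path \<Delta> x t\<bar> < e" if "t \<in> K" for t
          using grid_path_diff_le[of \<Delta> t T x' x] T[OF that] K(2) that assms
          unfolding V_def by force
        then show "x' \<in> grid_path \<Delta> -` U"
          using sub grid_path_in_path_space[OF assms] by blast
      qed
      ultimately show "\<exists>V. open V \<and> x \<in> V \<and> V \<subseteq> grid_path \<Delta> -` U" by blast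
    qed
    then show "grid_path \<Delta> -` U \<inter> space borel \<in> sets (borel :: (nat \<Rightarrow> real) measure)" by simp
  qed
  then show ?thesis
    by (simp cong: measurable_cong_sets add: sets_PiM_equal_borel)
qed

text \<open>
  Uniformly in \<open>t \<le> T\<close>, the two paths differ by at most \<open>\<delta> * C\<close> plus the \<open>L1\<close> distance on \<open>[0, T]\<close>
  of the two integrands, which vanishes by dominated convergence.
\<close>

lemma grid_paths_converge_to_integral:
  fixes \<delta> :: "nat \<Rightarrow> real" and x :: "nat \<Rightarrow> nat \<Rightarrow> real" and r :: "real \<Rightarrow> real"
  assumes \<delta>: "\<And>j. \<delta> j > 0" "\<delta> \<longlonglongrightarrow> 0"
    and C: "\<And>j n. \<bar>x j n\<bar> \<le> C" "\<And>t. t \<ge> 0 \<Longrightarrow> \<bar>r t\<bar> \<le> C"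
    and meas: "set_borel_measurable lborel {0..} r"
    and lim: "AE u in lborel. u \<ge> 0 \<longrightarrow> (\<lambda>j. x j (Suc (nat \<lfloor>u / \<delta> j\<rfloor>))) \<longlonglongrightarrow> r u"
  shows "limitin ucc_topology (\<lambda>j. grid_path (\<delta> j) (x j)) (\<lambda>t\<in>{0..}. LBINT u:{0..t}. r u) sequentially"
proof -
  let ?f = "\<lambda>j u. x j (Suc (nat \<lfloor>u / \<delta> j\<rfloor>))"
  have "C \<ge> 0" using C(1)[of 0 0] by linarith
  have f_int: "set_integrable lborel {0..t} (?f j)" for t j
    unfolding set_integrable_def
    by (rule integrableI_bounded_set[where A = "{0..t}" and B = C])
      (auto simp: C(1) \<open>C \<ge> 0\<close> emeasure_lborel_Icc_eq split: split_indicator)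
  have r_int: "set_integrable lborel {0..t} r" for t
    unfolding set_integrable_def
  proof (rule integrableI_bounded_set[where A = "{0..t}" and B = C])
    have "(\<lambda>u. indicator {0..t} u *\<^sub>R (indicator {0..} u *\<^sub>R r u)) \<in> borel_measurable lborel"
      using meas unfolding set_borel_measurable_def by measurable
    also have "(\<lambda>u. indicator {0..t} u *\<^sub>R (indicator {0..} u *\<^sub>R r u)) = (\<lambda>u. indicator {0..t} u *\<^sub>R r u)"
      by (auto simp: fun_eq_iff split: split_indicator)
    finally show "(\<lambda>u. indicator {0..t} u *\<^sub>R r u) \<in> borel_measurable lborel" .
  qed (auto simp: C(2) emeasure_lborel_Icc_eq split: split_indicator)
  have r_on: "r integrable_on {0..t}" for t
    using set_borel_integral_eq_integral(1)[OF r_int] .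
  have grid: "grid_path (\<delta> j) (x j) t = \<delta> j * x j 0 + (LBINT u:{0..t}. ?f j u)" if "t \<ge> 0" for j t
    using integral_unique[OF grid_path_has_integral[OF \<delta>(1)[of j] that, of "x j"]]
      set_borel_integral_eq_integral(2)[OF f_int, of t j] by simp
  define b where "b T j = \<delta> j * C + (LBINT u:{0..T}. \<bar>?f j u - r u\<bar>)" for T j
  show ?thesis
  proof (rule limitin_uccI)
    show "grid_path (\<delta> j) (x j) \<in> path_space" for j by (rule grid_path_in_path_space[OF \<delta>(1)])
    show "(\<lambda>t\<in>{0..}. LBINT u:{0..t}. r u) \<in> path_space"
    proof (rule path_spaceI)
      fix T :: real assume "T > 0"
      have "continuous_on {0..T} (\<lambda>t. integral {0..t} r)"
        by (rule indefinite_integral_continuous_1[OF r_on])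
      then show "continuous_on {0..T} (\<lambda>t\<in>{0..}. LBINT u:{0..t}. r u)"
        by (rule continuous_on_eq) (simp add: set_borel_integral_eq_integral(2)[OF r_int])
    qed simp
    show "b T \<longlonglongrightarrow> 0" if "T \<ge> 0" for T
    proof -
      have "(\<lambda>j. LBINT u:{0..T}. \<bar>?f j u - r u\<bar>) \<longlonglongrightarrow> (LBINT u:{0..T}. 0)"
        unfolding set_lebesgue_integral_def
      proof (rule integral_dominated_convergence[where w = "\<lambda>u. indicator {0..T} u * (2 * C)"])
        show "(\<lambda>u. indicator {0..T} u *\<^sub>R \<bar>?f j u - r u\<bar>) \<in> borel_measurable lborel" for j
          using set_integrable_abs[OF set_integral_diff(1)[OF f_int r_int], of T j]
          unfolding set_integrable_def by (rule borel_measurable_integrable)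
        show "AE u in lborel. (\<lambda>j. indicator {0..T} u *\<^sub>R \<bar>?f j u - r u\<bar>) \<longlonglongrightarrow> indicator {0..T} u *\<^sub>R (0::real)"
          using lim
        proof eventually_elim
          case (elim u)
          show ?case
          proof (cases "u \<in> {0..T}")
            case True
            then have "(\<lambda>j. \<bar>?f j u - r u\<bar>) \<longlonglongrightarrow> 0"
              using elim by (auto simp: LIM_zero_iff tendsto_rabs_zero_iff)
            then show ?thesis using True by simp
          qed simp
        qed
        show "AE u in lborel. norm (indicator {0..T} u *\<^sub>R \<bar>?f j u - r u\<bar>) \<le> indicator {0..T} u * (2 * C)" for j
        proof (rule AE_I2)
          fix u
          have "\<bar>?f j u - r u\<bar> \<le> 2 * C" if "u \<ge> 0"
            using C(1)[of j "Suc (nat \<lfloor>u / \<delta> j\<rfloor>)"] C(2)[OF that] by linarith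
          then show "norm (indicator {0..T} u *\<^sub>R \<bar>?f j u - r u\<bar>) \<le> indicator {0..T} u * (2 * C)"
            by (auto split: split_indicator)
        qed
      qed (auto simp: emeasure_lborel_Icc_eq)
      then have "(\<lambda>j. \<delta> j * C + (LBINT u:{0..T}. \<bar>?f j u - r u\<bar>)) \<longlonglongrightarrow> 0 * C + 0"
        by (intro tendsto_intros \<delta>(2)) (simp add: set_lebesgue_integral_def)
      then show ?thesis by (simp add: b_def[abs_def])
    qed
    fix j T t assume t: "0 \<le> t" "t \<le> (T::real)"
    have "\<bar>grid_path (\<delta> j) (x j) t - (\<lambda>t\<in>{0..}. LBINT u:{0..t}. r u) t\<bar>
        = \<bar>\<delta> j * x j 0 + (LBINT u:{0..t}. ?f j u - r u)\<bar>"
      using t by (simp add: grid set_integral_diff(2)[OF f_int r_int])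
    also have "\<dots> \<le> \<bar>\<delta> j * x j 0\<bar> + \<bar>LBINT u:{0..t}. ?f j u - r u\<bar>" by (rule abs_triangle_ineq)
    also have "\<bar>\<delta> j * x j 0\<bar> \<le> \<delta> j * C" using C(1) \<delta>(1)[of j] by (auto simp: abs_mult)
    also have "\<bar>LBINT u:{0..t}. ?f j u - r u\<bar> \<le> (LBINT u:{0..t}. \<bar>?f j u - r u\<bar>)"
      using set_integral_norm_bound[OF set_integral_diff(1)[OF f_int r_int, of t j]] by simp
    also have "\<dots> \<le> (LBINT u:{0..T}. \<bar>?f j u - r u\<bar>)"
      using t set_integrable_abs[OF set_integral_diff(1)[OF f_int r_int]]
      unfolding set_lebesgue_integral_def set_integrable_def
      by (intro integral_mono) (auto split: split_indicator)
    finally show "\<bar>grid_path (\<delta> j) (x j) t - (\<lambda>t\<in>{0..}. LBINT u:{0..t}. r u) t\<bar> \<le> b T j"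
      by (simp add: b_def)
  qed
qed

lemma next_grid_point:
  assumes "\<Delta> > 0" "u \<ge> 0"
  shows "u < \<Delta> * real (Suc (nat \<lfloor>u / \<Delta>\<rfloor>))" "\<Delta> * real (Suc (nat \<lfloor>u / \<Delta>\<rfloor>)) \<le> u + \<Delta>"
proof -
  define q where "q = u / \<Delta>"
  have q: "q \<ge> 0" "\<Delta> * q = u" using assms by (auto simp: q_def)
  then have "q < real (Suc (nat \<lfloor>q\<rfloor>))" "real (Suc (nat \<lfloor>q\<rfloor>)) \<le> q + 1" by linarith+
  then show "u < \<Delta> * real (Suc (nat \<lfloor>u / \<Delta>\<rfloor>))" "\<Delta> * real (Suc (nat \<lfloor>u / \<Delta>\<rfloor>)) \<le> u + \<Delta>"
    using mult_strict_left_mono[of q "real (Suc (nat \<lfloor>q\<rfloor>))" \<Delta>]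
      mult_left_mono[of "real (Suc (nat \<lfloor>q\<rfloor>))" "q + 1" \<Delta>] assms(1) q(2)
    unfolding q_def[symmetric] by (auto simp: algebra_simps)
qed

text \<open>
  The next grid point lies strictly to the right of \<open>u\<close>, which is why right-continuity suffices to
  recover a function from its values on the grids.
\<close>

lemma grid_point_tendsto_right:
  fixes \<delta> :: "nat \<Rightarrow> real"
  assumes \<delta>: "\<And>j. \<delta> j > 0" "\<delta> \<longlonglongrightarrow> 0" and u: "u \<ge> 0"
  shows "filterlim (\<lambda>j. \<delta> j * real (Suc (nat \<lfloor>u / \<delta> j\<rfloor>))) (at_right u) sequentially"
proof -
  note pos = next_grid_point[OF \<delta>(1) u]
  have "(\<lambda>j. \<delta> j * real (Suc (nat \<lfloor>u / \<delta> j\<rfloor>))) \<longlonglongrightarrow> u"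
  proof (rule tendsto_sandwich[where f = "\<lambda>_. u" and h = "\<lambda>j. u + \<delta> j"])
    show "(\<lambda>j. u + \<delta> j) \<longlonglongrightarrow> u" using tendsto_add[OF tendsto_const \<delta>(2), of u] by simp
  qed (use pos in \<open>auto intro!: always_eventually less_imp_le simp del: of_nat_Suc\<close>)
  then show ?thesis
    using pos(1) less_imp_neq[OF pos(1), symmetric]
    by (auto simp: filterlim_at intro!: always_eventually simp del: of_nat_Suc)
qed

lemma right_continuous_set_borel_measurable:
  fixes r :: "real \<Rightarrow> real"
  assumes "\<And>t. t \<ge> 0 \<Longrightarrow> continuous (at_right t) r"
  shows "set_borel_measurable lborel {0..} r"
  unfolding set_borel_measurable_def
proof (rule borel_measurable_LIMSEQ_real)
  let ?d = "\<lambda>j. inverse (real (Suc j))"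
  let ?f = "\<lambda>j u. indicator {0..} u *\<^sub>R r (?d j * real (Suc (nat \<lfloor>u / ?d j\<rfloor>)))"
  show "(\<lambda>j. ?f j u) \<longlonglongrightarrow> indicator {0..} u *\<^sub>R r u" for u
  proof (cases "u \<ge> 0")
    case True
    have "(r \<longlongrightarrow> r u) (at_right u)" using assms[OF True] by (simp add: continuous_within)
    then have "(\<lambda>j. r (?d j * real (Suc (nat \<lfloor>u / ?d j\<rfloor>)))) \<longlonglongrightarrow> r u"
      by (rule filterlim_compose[OF _ grid_point_tendsto_right[OF _ LIMSEQ_inverse_real_of_nat True]]) simp
    then show ?thesis by (intro tendsto_intros)
  qed simp
  show "?f j \<in> borel_measurable lborel" for j
  proof -
    have "(\<lambda>n. r (?d j * real (Suc n))) \<in> borel_measurable (count_space UNIV)" by simp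
    moreover have "(\<lambda>u. nat \<lfloor>u / ?d j\<rfloor>) \<in> measurable lborel (count_space UNIV)" by measurable
    ultimately have "(\<lambda>u. r (?d j * real (Suc (nat \<lfloor>u / ?d j\<rfloor>)))) \<in> borel_measurable lborel"
      by (rule measurable_compose[rotated])
    then show ?thesis by measurable
  qed
qed

lemma measurable_sequence_of_finite_range:
  fixes e :: "'i \<Rightarrow> real"
  assumes U: "\<And>n. U n \<in> measurable M (count_space (e ` I))"
  shows "(\<lambda>\<omega> n. U n \<omega>) \<in> measurable M (PiM UNIV (\<lambda>_::nat. borel))"
proof -
  have "U n \<in> borel_measurable M" for n
    using measurable_compose[OF U, of "\<lambda>x. x" borel] by simp
  then show ?thesis by (intro measurable_PiM_single') auto
qed

text \<open>
  Sampling \<open>R\<close> on finer and finer grids gives random sequences whose polygonal paths are measurable and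
  converge to the integral path at every sample point.
\<close>

lemma measurable_integral_path:
  fixes y :: "nat \<Rightarrow> real" and R :: "real \<Rightarrow> 'b \<Rightarrow> real"
  assumes R: "\<And>t. t \<ge> 0 \<Longrightarrow> R t \<in> measurable N (count_space (y ` {1..k}))"
    and cont: "\<And>\<omega> t. \<omega> \<in> space N \<Longrightarrow> t \<ge> 0 \<Longrightarrow> continuous (at_right t) (\<lambda>s. R s \<omega>)"
    and C: "\<And>j. j \<in> {1..k} \<Longrightarrow> \<bar>y j\<bar> \<le> C"
  shows "path_of (\<lambda>t \<omega>. LBINT s:{0..t}. R s \<omega>) \<in> measurable N (borel_of ucc_topology)"
proof (rule measurable_ucc_limit)
  let ?d = "\<lambda>j. inverse (real (Suc j))"
  show "(\<lambda>\<omega>. grid_path (?d j) (\<lambda>n. R (?d j * real n) \<omega>)) \<in> measurable N (borel_of ucc_topology)" for j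
    by (rule measurable_compose[OF measurable_sequence_of_finite_range measurable_grid_path]) (auto intro: R)
  fix \<omega> assume \<omega>: "\<omega> \<in> space N"
  have bound: "\<bar>R t \<omega>\<bar> \<le> C" if "t \<ge> 0" for t
    using measurable_space[OF R[OF that] \<omega>] C by auto
  show "limitin ucc_topology (\<lambda>j. grid_path (?d j) (\<lambda>n. R (?d j * real n) \<omega>))
      (path_of (\<lambda>t \<omega>. LBINT s:{0..t}. R s \<omega>) \<omega>) sequentially"
    unfolding path_of_def
  proof (rule grid_paths_converge_to_integral)
    show "?d \<longlonglongrightarrow> 0" by (rule LIMSEQ_inverse_real_of_nat)
    show "set_borel_measurable lborel {0..} (\<lambda>s. R s \<omega>)"
      by (rule right_continuous_set_borel_measurable) (rule cont[OF \<omega>])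
    show "AE u in lborel. u \<ge> 0 \<longrightarrow> (\<lambda>j. R (?d j * real (Suc (nat \<lfloor>u / ?d j\<rfloor>))) \<omega>) \<longlonglongrightarrow> R u \<omega>"
    proof (intro AE_I2 impI)
      fix u :: real assume u: "u \<ge> 0"
      have "((\<lambda>s. R s \<omega>) \<longlongrightarrow> R u \<omega>) (at_right u)" using cont[OF \<omega> u] by (simp add: continuous_within)
      then show "(\<lambda>j. R (?d j * real (Suc (nat \<lfloor>u / ?d j\<rfloor>))) \<omega>) \<longlonglongrightarrow> R u \<omega>"
        by (rule filterlim_compose[OF _ grid_point_tendsto_right[OF _ LIMSEQ_inverse_real_of_nat u]]) simp
    qed
  qed (auto intro!: bound)
qed

section \<open>Runs of a piecewise constant sequence\<close>

text \<open>
  If \<open>G m\<close> is the length of the \<open>m\<close>-th run of a sequence, the number of the run that contains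
  position \<open>t\<close>.
\<close>

definition run_index :: "(nat \<Rightarrow> nat) \<Rightarrow> nat \<Rightarrow> nat" where
  "run_index G t = (LEAST n. t < (\<Sum>m\<le>n. G m))"

lemma run_index_eqI:
  assumes "(\<Sum>m<n. G m) \<le> t" "t < (\<Sum>m\<le>n. G m)"
  shows "run_index G t = n"
  unfolding run_index_def
proof (rule Least_equality)
  fix l assume l: "t < (\<Sum>m\<le>l. G m)"
  show "n \<le> l"
  proof (rule ccontr)
    assume "\<not> n \<le> l"
    then have "(\<Sum>m\<le>l. G m) \<le> (\<Sum>m<n. G m)" by (intro sum_mono2) auto
    then show False using l assms by linarith
  qed
qed (fact assms(2))

text \<open>
  Since consecutive runs have different levels, the first \<open>T + 1\<close> values of a sequence determine the
  levels \<open>a\<close> of the runs seen so far, the lengths \<open>g\<close> of the completed ones, and that the current run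
  is longer than the number \<open>r\<close> of its steps already taken.  The second part groups a product over
  transitions accordingly; for Markov transition probabilities it is the probability of these
  runs.  By induction on \<open>T\<close>: the next value either prolongs the current run or starts a new one.
\<close>

lemma run_event_iff:
  fixes b :: "nat \<Rightarrow> 'i"
  assumes "\<forall>t\<le>T. b t \<in> I"
  shows "\<exists>n a g r. a \<in> {..n} \<rightarrow> I \<and> a 0 = b 0 \<and> a n = b T \<and> (\<forall>m<n. g m \<ge> 1 \<and> a (Suc m) \<noteq> a m) \<and>
    (\<Sum>m<n. g m) + r = T \<and>
    (\<forall>J G. (\<forall>m. G m \<ge> (1::nat)) \<longrightarrow> (\<forall>m. J (Suc m) \<noteq> J m) \<longrightarrow>
       (\<forall>t\<le>T. J (run_index G t) = b t) \<longleftrightarrow>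
       (\<forall>m\<le>n. J m = a m) \<and> (\<forall>m<n. G m = g m) \<and> r < G n) \<and>
    (\<forall>p :: 'i \<Rightarrow> 'i \<Rightarrow> real. (\<Prod>t<T. p (b t) (b (Suc t))) =
       (\<Prod>m<n. p (a m) (a m) ^ (g m - 1) * p (a m) (a (Suc m))) * p (a n) (a n) ^ r)"
  using assms
proof (induction T)
  case 0
  have "run_index G 0 = 0" if "\<forall>m. G m \<ge> (1::nat)" for G
    using that[rule_format, of 0] by (intro run_index_eqI) auto
  moreover have "0 < G 0" if "\<forall>m. G m \<ge> (1::nat)" for G :: "nat \<Rightarrow> nat"
    using that[rule_format, of 0] by simp
  ultimately show ?case using 0
    by (intro exI[of _ 0] exI[of _ "\<lambda>_. b 0"] exI[of _ "\<lambda>_. 1"]) auto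
next
  case (Suc T)
  have "\<forall>t\<le>T. b t \<in> I" using Suc.prems by simp
  from Suc.IH[OF this] obtain n a g r where
    a: "a \<in> {..n} \<rightarrow> I" "a 0 = b 0" "a n = b T"
    and g: "\<forall>m<n. g m \<ge> 1 \<and> a (Suc m) \<noteq> a m" "(\<Sum>m<n. g m) + r = T"
    and iff': "\<forall>J G. (\<forall>m. G m \<ge> (1::nat)) \<longrightarrow> (\<forall>m. J (Suc m) \<noteq> J m) \<longrightarrow>
       (\<forall>t\<le>T. J (run_index G t) = b t) \<longleftrightarrow>
       (\<forall>m\<le>n. J m = a m) \<and> (\<forall>m<n. G m = g m) \<and> r < G n"
    and prod: "\<forall>p :: 'i \<Rightarrow> 'i \<Rightarrow> real. (\<Prod>t<T. p (b t) (b (Suc t))) =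
       (\<Prod>m<n. p (a m) (a m) ^ (g m - 1) * p (a m) (a (Suc m))) * p (a n) (a n) ^ r"
    by - (elim exE conjE, rule that, assumption+)
  have same: "run_index G (Suc T) = n"
    if "\<forall>m<n. G m = g m" "Suc r < G n" for G
    using that g(2) by (intro run_index_eqI) (auto simp: lessThan_Suc_atMost[symmetric])
  have next_run: "run_index G (Suc T) = Suc n"
    if "\<forall>m<n. G m = g m" "G n = Suc r" "\<forall>m. G m \<ge> 1" for G
    using that(1,2) g(2) that(3)[rule_format, of "Suc n"]
    by (intro run_index_eqI) (auto simp: lessThan_Suc_atMost[symmetric])
  have all_Suc: "(\<forall>t\<le>Suc T. P t) \<longleftrightarrow> (\<forall>t\<le>T. P t) \<and> P (Suc T)" for P
    by (auto simp: le_Suc_eq)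
  show ?case
  proof (cases "b (Suc T) = b T")
    case True
    have "(\<forall>t\<le>Suc T. J (run_index G t) = b t) \<longleftrightarrow>
       (\<forall>m\<le>n. J m = a m) \<and> (\<forall>m<n. G m = g m) \<and> Suc r < G n"
      if "\<forall>m. G m \<ge> (1::nat)" "\<forall>m. J (Suc m) \<noteq> J m" for J G
    proof (cases "(\<forall>m\<le>n. J m = a m) \<and> (\<forall>m<n. G m = g m) \<and> r < G n")
      case run: True
      then have "J n = b T" using a(3) by simp
      consider "G n = Suc r" | "Suc r < G n" using run by linarith
      then show ?thesis
      proof cases
        case 1
        then have "J (run_index G (Suc T)) \<noteq> b (Suc T)"
          using next_run[of G] run that \<open>J n = b T\<close> True by metis
        then show ?thesis using 1 by auto
      next
        case 2
        then have "J (run_index G (Suc T)) = b (Suc T)"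
          using same[of G] run \<open>J n = b T\<close> True by simp
        then show ?thesis unfolding all_Suc iff'[THEN spec, THEN spec, THEN mp, THEN mp, OF that]
          using 2 run by blast
      qed
    next
      case False
      then show ?thesis unfolding all_Suc iff'[THEN spec, THEN spec, THEN mp, THEN mp, OF that]
        using Suc_lessD by blast
    qed
    then show ?thesis
      using a g prod True
      by (intro exI[of _ n] exI[of _ a] exI[of _ g] exI[of _ "Suc r"]) auto
  next
    case False
    define a' where "a' = a(Suc n := b (Suc T))"
    define g' where "g' = g(n := Suc r)"
    have "(\<forall>t\<le>Suc T. J (run_index G t) = b t) \<longleftrightarrow>
       (\<forall>m\<le>Suc n. J m = a' m) \<and> (\<forall>m<Suc n. G m = g' m) \<and> 0 < G (Suc n)"
      if GJ: "\<forall>m. G m \<ge> (1::nat)" "\<forall>m. J (Suc m) \<noteq> J m" for J G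
    proof -
      have "0 < G (Suc n)" using GJ(1)[rule_format, of "Suc n"] by simp
      moreover have "(\<forall>m\<le>Suc n. J m = a' m) \<longleftrightarrow> (\<forall>m\<le>n. J m = a m) \<and> J (Suc n) = b (Suc T)"
        by (auto simp: a'_def le_Suc_eq)
      moreover have "(\<forall>m<Suc n. G m = g' m) \<longleftrightarrow> (\<forall>m<n. G m = g m) \<and> G n = Suc r"
        by (auto simp: g'_def less_Suc_eq)
      moreover have "(\<forall>t\<le>Suc T. J (run_index G t) = b t) \<longleftrightarrow>
         ((\<forall>m\<le>n. J m = a m) \<and> J (Suc n) = b (Suc T)) \<and> (\<forall>m<n. G m = g m) \<and> G n = Suc r"
      proof (cases "(\<forall>m\<le>n. J m = a m) \<and> (\<forall>m<n. G m = g m) \<and> r < G n")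
        case run: True
        then have "J n = b T" using a(3) by simp
        consider "G n = Suc r" | "Suc r < G n" using run by linarith
        then show ?thesis
        proof cases
          case 1
          then have "J (run_index G (Suc T)) = J (Suc n)"
            using next_run[of G] run GJ(1) by simp
          then show ?thesis unfolding all_Suc iff'[THEN spec, THEN spec, THEN mp, THEN mp, OF GJ]
            using 1 run by auto
        next
          case 2
          then have "J (run_index G (Suc T)) \<noteq> b (Suc T)"
            using same[of G] run \<open>J n = b T\<close> False by simp
          then show ?thesis using 2 by auto
        qed
      next
        case False
        then show ?thesis unfolding all_Suc iff'[THEN spec, THEN spec, THEN mp, THEN mp, OF GJ]
          by auto
      qed
      ultimately show ?thesis by blast
    qed
    moreover have "(\<Prod>t<Suc T. p (b t) (b (Suc t))) =
       (\<Prod>m<Suc n. p (a' m) (a' m) ^ (g' m - 1) * p (a' m) (a' (Suc m))) * p (a' (Suc n)) (a' (Suc n)) ^ 0"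
      for p :: "'i \<Rightarrow> 'i \<Rightarrow> real"
    proof -
      have "(\<Prod>m<n. p (a' m) (a' m) ^ (g' m - 1) * p (a' m) (a' (Suc m)))
          = (\<Prod>m<n. p (a m) (a m) ^ (g m - 1) * p (a m) (a (Suc m)))"
        by (intro prod.cong) (auto simp: a'_def g'_def)
      then show ?thesis using prod[rule_format, of p] a(3) by (simp add: a'_def g'_def)
    qed
    moreover have "a' \<in> {..Suc n} \<rightarrow> I"
      using a(1) Suc.prems by (auto simp: a'_def le_Suc_eq)
    moreover have "(\<Sum>m<Suc n. g' m) + 0 = Suc T"
    proof -
      have "(\<Sum>m<n. g' m) = (\<Sum>m<n. g m)" by (intro sum.cong) (auto simp: g'_def)
      then show ?thesis using g(2) by (simp add: g'_def)
    qed
    moreover have "a' 0 = b 0" "a' (Suc n) = b (Suc T)" "\<forall>m<Suc n. g' m \<ge> 1 \<and> a' (Suc m) \<noteq> a' m"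
      using a g False by (auto simp: a'_def g'_def less_Suc_eq)
    ultimately show ?thesis
      by (intro exI[of _ "Suc n"] exI[of _ a'] exI[of _ g'] exI[of _ 0]) blast
  qed
qed

text \<open>
  The first \<open>n\<close> runs end near \<open>(\<Sum>m<n. S m) / \<delta>\<close>, so a position near \<open>u / \<delta>\<close> falls into run number \<open>n\<close>
  once the errors are smaller than the distance of \<open>u\<close> to the endpoints of its interval.
\<close>

lemma run_index_at_position:
  fixes \<delta> :: "nat \<Rightarrow> real" and G :: "nat \<Rightarrow> nat \<Rightarrow> nat"
  assumes \<delta>: "\<And>j. \<delta> j > 0" "\<delta> \<longlonglongrightarrow> 0"
    and G: "\<And>m. (\<lambda>j. \<delta> j * real (G j m)) \<longlonglongrightarrow> S m"
    and u: "u \<ge> 0" "(\<Sum>m<n. S m) < u" "u < (\<Sum>m<Suc n. S m)"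
  shows "\<forall>\<^sub>F j in sequentially. run_index (G j) (Suc (nat \<lfloor>u / \<delta> j\<rfloor>)) = n"
proof -
  have partial: "(\<lambda>j. \<delta> j * real (\<Sum>m<n. G j m)) \<longlonglongrightarrow> (\<Sum>m<n. S m)" for n
    using tendsto_sum[of "{..<n}" "\<lambda>m j. \<delta> j * real (G j m)" S sequentially] G
    by (simp add: sum_distrib_left)
  note pos = next_grid_point[OF \<delta>(1) u(1)]
  have "(\<lambda>j. \<delta> j * real (\<Sum>m<Suc n. G j m) - \<delta> j) \<longlonglongrightarrow> (\<Sum>m<Suc n. S m) - 0"
    by (intro tendsto_diff partial \<delta>(2))
  then have "\<forall>\<^sub>F j in sequentially. u < \<delta> j * real (\<Sum>m<Suc n. G j m) - \<delta> j"
    using u(3) by (intro order_tendstoD(1)) auto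
  moreover have "\<forall>\<^sub>F j in sequentially. \<delta> j * real (\<Sum>m<n. G j m) < u"
    using order_tendstoD(2)[OF partial u(2)] .
  ultimately show ?thesis
  proof eventually_elim
    case (elim j)
    have "\<delta> j * real (\<Sum>m<n. G j m) < \<delta> j * real (Suc (nat \<lfloor>u / \<delta> j\<rfloor>))"
      "\<delta> j * real (Suc (nat \<lfloor>u / \<delta> j\<rfloor>)) < \<delta> j * real (\<Sum>m<Suc n. G j m)"
      using elim pos[of j] by linarith+
    then have "(\<Sum>m<n. G j m) < Suc (nat \<lfloor>u / \<delta> j\<rfloor>)" "Suc (nat \<lfloor>u / \<delta> j\<rfloor>) < (\<Sum>m<Suc n. G j m)"
      using \<delta>(1)[of j] unfolding mult_less_cancel_left_pos[OF \<delta>(1)] of_nat_less_iff by blast+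
    then show ?case
      by (intro run_index_eqI) (auto simp: lessThan_Suc_atMost[symmetric])
  qed
qed

section \<open>Laws of sequences with finitely many values\<close>

lemma path_event_measurable:
  fixes U :: "nat \<Rightarrow> 'a \<Rightarrow> 's"
  assumes U: "\<And>n. U n \<in> measurable M (count_space A)"
  shows "{\<omega> \<in> space M. \<forall>m\<le>n. U m \<omega> = b m} \<in> sets M"
proof -
  have "{\<omega> \<in> space M. \<forall>m\<le>n. U m \<omega> = b m} = (\<Inter>m\<le>n. U m -` ({b m} \<inter> A) \<inter> space M)"
    using measurable_space[OF U] by auto
  also have "\<dots> \<in> sets M"
    by (intro sets.finite_INT measurable_sets[OF U]) auto
  finally show ?thesis .
qed

lemma sum_over_finite_paths:
  fixes U :: "nat \<Rightarrow> 'a \<Rightarrow> 's"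
  assumes "finite_measure M" "finite I" "inj_on e I"
    and U: "\<And>n. U n \<in> measurable M (count_space (e ` I))"
    and E: "E \<in> sets M"
  shows "measure M E =
    (\<Sum>a\<in>PiE {..n} (\<lambda>_. I). measure M (E \<inter> {\<omega> \<in> space M. \<forall>m\<le>n. U m \<omega> = e (a m)}))"
proof -
  interpret finite_measure M by fact
  define D where "D a = E \<inter> {\<omega> \<in> space M. \<forall>m\<le>n. U m \<omega> = e (a m)}" for a
  have "E = (\<Union>a\<in>PiE {..n} (\<lambda>_. I). D a)"
  proof (intro equalityI subsetI)
    fix \<omega> assume \<omega>: "\<omega> \<in> E"
    then have sp: "\<omega> \<in> space M" using sets.sets_into_space[OF E] by auto
    define a where "a = (\<lambda>m\<in>{..n}. inv_into I e (U m \<omega>))"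
    have "U m \<omega> \<in> e ` I" for m using measurable_space[OF U sp] by simp
    then have "a \<in> PiE {..n} (\<lambda>_. I)" "\<forall>m\<le>n. U m \<omega> = e (a m)"
      by (auto simp: a_def inv_into_into f_inv_into_f)
    then show "\<omega> \<in> (\<Union>a\<in>PiE {..n} (\<lambda>_. I). D a)" using sp \<omega> unfolding D_def by blast
  qed (auto simp: D_def)
  moreover have "disjoint_family_on D (PiE {..n} (\<lambda>_. I))"
    unfolding disjoint_family_on_def
  proof safe
    fix a a' \<omega>
    assume aa: "a \<in> PiE {..n} (\<lambda>_. I)" "a' \<in> PiE {..n} (\<lambda>_. I)" "a \<noteq> a'" "\<omega> \<in> D a" "\<omega> \<in> D a'"
    have "a m = a' m" if "m \<in> {..n}" for m
    proof -
      have "e (a m) = e (a' m)" using aa(4,5) that by (auto simp: D_def)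
      then show ?thesis using aa(1,2) that assms(3) by (auto dest!: inj_onD)
    qed
    then have "a = a'" using aa(1,2) by (auto intro: PiE_ext)
    then show "\<omega> \<in> {}" using aa(3) by simp
  qed
  ultimately have "measure M E = (\<Sum>a\<in>PiE {..n} (\<lambda>_. I). measure M (D a))"
    using E \<open>finite I\<close> by (subst finite_measure_finite_Union[symmetric])
      (auto simp: D_def intro: finite_PiE intro!: sets.Int path_event_measurable[OF U])
  then show ?thesis by (simp add: D_def)
qed

lemma markov_chain_path_prob:
  assumes mc: "markov_chain M I e p i Y" and e: "inj_on e I" and i: "i \<in> I"
    and a: "a \<in> {..n} \<rightarrow> I"
  shows "measure M {\<omega> \<in> space M. \<forall>m\<le>n. Y m \<omega> = e (a m)} =
    of_bool (a 0 = i) * (\<Prod>m<n. p (a m) (a (Suc m)))"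
  using a
proof (induction n)
  case 0
  interpret prob_space M using mc by (simp add: markov_chain_def)
  have init: "AE \<omega> in M. Y 0 \<omega> = e i" using mc by (simp add: markov_chain_def)
  have sets: "{\<omega> \<in> space M. \<forall>m\<le>0. Y m \<omega> = e (a m)} \<in> sets M"
    using mc by (intro path_event_measurable) (auto simp: markov_chain_def)
  show ?case
  proof (cases "a 0 = i")
    case True
    have "prob {\<omega> \<in> space M. \<forall>m\<le>0. Y m \<omega> = e (a m)} = 1"
      by (subst prob_Collect_eq_1[OF sets]) (use init True in auto)
    then show ?thesis using True by simp
  next
    case False
    then have "e (a 0) \<noteq> e i" using 0 i e by (auto simp: inj_on_eq_iff)
    have "prob {\<omega> \<in> space M. \<forall>m\<le>0. Y m \<omega> = e (a m)} = 0"
      by (subst prob_Collect_eq_0[OF sets]) (use init \<open>e (a 0) \<noteq> e i\<close> in auto)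
    then show ?thesis using False by simp
  qed
next
  case (Suc n)
  interpret prob_space M using mc by (simp add: markov_chain_def)
  let ?A = "{\<omega> \<in> space M. \<forall>m\<le>n. Y m \<omega> = e (a m)}"
  let ?B = "{\<omega> \<in> space M. \<forall>m\<le>Suc n. Y m \<omega> = e (a m)}"
  have IH: "prob ?A = of_bool (a 0 = i) * (\<Prod>m<n. p (a m) (a (Suc m)))"
    using Suc.prems by (intro Suc.IH) auto
  have B: "?B = {\<omega> \<in> space M. Y (Suc n) \<omega> = e (a (Suc n)) \<and> (\<forall>m\<le>n. Y m \<omega> = e (a m))}"
    by (auto simp: le_Suc_eq)
  have "prob ?B = prob ?A * p (a n) (a (Suc n))"
  proof (cases "prob ?A > 0")
    case True
    have "\<forall>n a. a \<in> {..Suc n} \<rightarrow> I \<longrightarrow>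
        \<P>(\<omega> in M. \<forall>m\<le>n. Y m \<omega> = e (a m)) > 0 \<longrightarrow>
        \<P>(\<omega> in M. Y (Suc n) \<omega> = e (a (Suc n)) \<bar> \<forall>m\<le>n. Y m \<omega> = e (a m)) = p (a n) (a (Suc n))"
      using mc by (simp add: markov_chain_def)
    from this[THEN spec, THEN spec, THEN mp, THEN mp, OF Suc.prems True]
    have quot: "prob ?B / prob ?A = p (a n) (a (Suc n))"
      unfolding cond_prob_def B .
    have "prob ?A \<noteq> 0" using True by linarith
    then have "prob ?B = p (a n) (a (Suc n)) * prob ?A"
      by (rule nonzero_divide_eq_eq[THEN iffD1, OF _ quot])
    then show ?thesis by (rule trans[OF _ mult.commute])
  next
    case False
    have "?A \<in> sets M"
      using mc by (intro path_event_measurable) (auto simp: markov_chain_def)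
    then have "prob ?B \<le> prob ?A" by (rule finite_measure_mono[rotated]) auto
    moreover have "prob ?A = 0" using False measure_nonneg[of M ?A] by linarith
    ultimately have "prob ?B = 0" using measure_nonneg[of M ?B] by linarith
    then show ?thesis using \<open>prob ?A = 0\<close> by (simp only: mult_zero_left)
  qed
  then show ?case by (simp add: IH)
qed

lemma cylinder_prob_via_paths:
  fixes e :: "'i \<Rightarrow> real"
  assumes M: "finite_measure M" and I: "finite I" "inj_on e I"
    and U: "\<And>n. U n \<in> measurable M (count_space (e ` I))"
    and J: "finite J" "J \<subseteq> {..n}" and A: "\<And>j. j \<in> J \<Longrightarrow> A j \<in> sets borel"
  defines "X \<equiv> prod_emb UNIV (\<lambda>_::nat. borel) J (Pi\<^sub>E J A)"
  shows "measure M ((\<lambda>\<omega> n. U n \<omega>) -` X \<inter> space M) =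
    (\<Sum>a\<in>PiE {..n} (\<lambda>_. I). if \<forall>j\<in>J. e (a j) \<in> A j
       then measure M {\<omega> \<in> space M. \<forall>m\<le>n. U m \<omega> = e (a m)} else 0)"
proof -
  have "X \<in> sets (PiM UNIV (\<lambda>_. borel))" unfolding X_def using J A by (intro sets_PiM_I) auto
  from measurable_sets[OF measurable_sequence_of_finite_range[OF U] this]
  have E: "(\<lambda>\<omega> n. U n \<omega>) -` X \<inter> space M \<in> sets M" .
  have "measure M (((\<lambda>\<omega> n. U n \<omega>) -` X \<inter> space M) \<inter> {\<omega> \<in> space M. \<forall>m\<le>n. U m \<omega> = e (a m)})
    = (if \<forall>j\<in>J. e (a j) \<in> A j
      then measure M {\<omega> \<in> space M. \<forall>m\<le>n. U m \<omega> = e (a m)} else 0)" for a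
  proof -
    have *: "((\<lambda>\<omega> n. U n \<omega>) -` X \<inter> space M) \<inter> {\<omega> \<in> space M. \<forall>m\<le>n. U m \<omega> = e (a m)}
      = (if \<forall>j\<in>J. e (a j) \<in> A j then {\<omega> \<in> space M. \<forall>m\<le>n. U m \<omega> = e (a m)} else {})"
      using J(2) by (auto simp: X_def prod_emb_def PiE_iff subset_iff)
    show ?thesis unfolding * by simp
  qed
  then show ?thesis
    by (subst sum_over_finite_paths[where U = U and n = n, OF M I U E]) simp
qed

text \<open>
  Cylinder sets generate the product measure space, and each of them is, up to the values that the
  sequence never takes, a finite union of sets of sequences with prescribed initial values.
\<close>

lemma distr_eq_of_path_probs:
  fixes e :: "'i \<Rightarrow> real"
  assumes M: "prob_space M" and N: "prob_space N" and I: "finite I" "inj_on e I"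
    and U: "\<And>n. U n \<in> measurable M (count_space (e ` I))"
    and V: "\<And>n. V n \<in> measurable N (count_space (e ` I))"
    and eq: "\<And>n a. a \<in> {..n} \<rightarrow> I \<Longrightarrow> measure M {\<omega> \<in> space M. \<forall>m\<le>n. U m \<omega> = e (a m)}
      = measure N {\<omega> \<in> space N. \<forall>m\<le>n. V m \<omega> = e (a m)}"
  shows "distr M (PiM UNIV (\<lambda>_::nat. borel)) (\<lambda>\<omega> n. U n \<omega>)
    = distr N (PiM UNIV (\<lambda>_::nat. borel)) (\<lambda>\<omega> n. V n \<omega>)"
proof -
  note Um = measurable_sequence_of_finite_range[where U = U, OF U]
  note Vm = measurable_sequence_of_finite_range[where U = V, OF V]
  interpret M: prob_space M by fact
  interpret N: prob_space N by fact
  show ?thesis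
  proof (rule measure_eqI_PiM_infinite)
    show "finite_measure (distr M (PiM UNIV (\<lambda>_::nat. borel)) (\<lambda>\<omega> n. U n \<omega>))"
      using M.prob_space_distr[OF Um] by (simp add: prob_space.finite_measure)
    fix A :: "nat \<Rightarrow> real set" and J :: "nat set"
    assume J: "finite J" "J \<subseteq> UNIV" and A: "\<And>j. j \<in> J \<Longrightarrow> A j \<in> sets borel"
    obtain n where n: "J \<subseteq> {..n}" using J(1) finite_nat_iff_bounded_le by blast
    let ?X = "prod_emb UNIV (\<lambda>_. borel) J (Pi\<^sub>E J A) :: (nat \<Rightarrow> real) set"
    have X: "?X \<in> sets (PiM UNIV (\<lambda>_. borel))" using J A by (intro sets_PiM_I) auto
    have "measure M ((\<lambda>\<omega> n. U n \<omega>) -` ?X \<inter> space M) = measure N ((\<lambda>\<omega> n. V n \<omega>) -` ?X \<inter> space N)"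
    proof -
      have "measure M ((\<lambda>\<omega> n. U n \<omega>) -` ?X \<inter> space M) =
        (\<Sum>a\<in>PiE {..n} (\<lambda>_. I). if \<forall>j\<in>J. e (a j) \<in> A j
          then measure M {\<omega> \<in> space M. \<forall>m\<le>n. U m \<omega> = e (a m)} else 0)"
        by (rule cylinder_prob_via_paths[OF M.finite_measure_axioms I U J(1) n]) (use A in auto)
      also have "\<dots> = (\<Sum>a\<in>PiE {..n} (\<lambda>_. I). if \<forall>j\<in>J. e (a j) \<in> A j
          then measure N {\<omega> \<in> space N. \<forall>m\<le>n. V m \<omega> = e (a m)} else 0)"
        by (intro sum.cong refl) (use eq in \<open>auto simp: PiE_def\<close>)
      also have "\<dots> = measure N ((\<lambda>\<omega> n. V n \<omega>) -` ?X \<inter> space N)"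
        by (rule cylinder_prob_via_paths[OF N.finite_measure_axioms I V J(1) n, symmetric]) (use A in auto)
      finally show ?thesis .
    qed
    then show "emeasure (distr M (PiM UNIV (\<lambda>_. borel)) (\<lambda>\<omega> n. U n \<omega>)) ?X
      = emeasure (distr N (PiM UNIV (\<lambda>_. borel)) (\<lambda>\<omega> n. V n \<omega>)) ?X"
      using X by (simp add: emeasure_distr Um Vm M.emeasure_eq_measure N.emeasure_eq_measure)
  qed auto
qed

section \<open>Geometric holding times as rounded exponential ones\<close>

text \<open>
  The unit of time is chosen such that an exponential variable of rate \<open>l\<close> exceeds it with probability
  \<open>1 - l * \<Delta>\<close>.  The maximum with \<open>1\<close> makes every run nonempty also at the exceptional sample points
  where a holding time is not positive.
\<close>

definition holding_steps :: "real \<Rightarrow> real \<Rightarrow> real \<Rightarrow> nat" where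
  "holding_steps \<Delta> l s = max 1 (nat \<lceil>s / (- ln (1 - l * \<Delta>) / l)\<rceil>)"

abbreviation exponential_law :: "real \<Rightarrow> real measure" where
  "exponential_law l \<equiv> density lborel (\<lambda>x. ennreal (exponential_density l x))"

lemma exponential_law_tail:
  assumes "l > 0" "a \<ge> 0"
  shows "measure (exponential_law l) {x. a < x} = exp (- a * l)"
proof -
  interpret prob_space "exponential_law l" by (rule prob_space_exponential_density) fact
  have "distributed (exponential_law l) lborel (\<lambda>x. x) (\<lambda>x. ennreal (exponential_density l x))"
    unfolding distributed_def
    by (auto simp: distr_id2 intro!: measurable_ident_sets distr_id2)
  from exponential_distributedD_gt[OF this assms(2,1)]
  show ?thesis by simp
qed

lemma less_holding_steps_iff:
  assumes "l > 0" "\<Delta> > 0" "l * \<Delta> < 1"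
  shows "r < holding_steps \<Delta> l s \<longleftrightarrow> r = 0 \<or> real r * (- ln (1 - l * \<Delta>) / l) < s"
proof -
  define h where "h = - ln (1 - l * \<Delta>) / l"
  have h: "h > 0" unfolding h_def using assms by (simp add: divide_neg_pos)
  have ceil: "r < nat \<lceil>x\<rceil> \<longleftrightarrow> real r < x" for x :: real
    by linarith
  have "r < holding_steps \<Delta> l s \<longleftrightarrow> r < 1 \<or> r < nat \<lceil>s / h\<rceil>"
    unfolding holding_steps_def h_def by (rule less_max_iff_disj)
  also have "\<dots> \<longleftrightarrow> r = 0 \<or> real r * h < s"
    unfolding ceil pos_less_divide_eq[OF h] by auto
  finally show ?thesis unfolding h_def .
qed

lemma measurable_holding_steps [measurable]:
  "holding_steps \<Delta> l \<in> measurable borel (count_space UNIV)"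
  unfolding holding_steps_def by measurable

lemma holding_steps_tail:
  assumes "l > 0" "\<Delta> > 0" "l * \<Delta> < 1"
  shows "measure (exponential_law l) {s. r < holding_steps \<Delta> l s} = (1 - l * \<Delta>) ^ r"
proof (cases "r = 0")
  case True
  interpret prob_space "exponential_law l" by (rule prob_space_exponential_density) fact
  show ?thesis using True prob_space by (simp add: less_holding_steps_iff[OF assms])
next
  case False
  have h: "- ln (1 - l * \<Delta>) / l > 0" using assms by (simp add: divide_neg_pos)
  have "measure (exponential_law l) {s. r < holding_steps \<Delta> l s} = exp (real r * ln (1 - l * \<Delta>))"
  proof -
    have "measure (exponential_law l) {s. r < holding_steps \<Delta> l s}
        = measure (exponential_law l) {s. real r * (- ln (1 - l * \<Delta>) / l) < s}"
      using False by (simp add: less_holding_steps_iff[OF assms] del: mult_minus_right)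
    also have "\<dots> = exp (- (real r * (- ln (1 - l * \<Delta>) / l)) * l)"
      by (intro exponential_law_tail mult_nonneg_nonneg) (use h assms in auto)
    finally show ?thesis using assms by simp
  qed
  also have "\<dots> = (1 - l * \<Delta>) ^ r" using assms by (simp add: exp_of_nat_mult)
  finally show ?thesis .
qed

lemma holding_steps_point:
  assumes "l > 0" "\<Delta> > 0" "l * \<Delta> < 1" "g \<ge> 1"
  shows "measure (exponential_law l) {s. holding_steps \<Delta> l s = g} = (1 - l * \<Delta>) ^ (g - 1) * (l * \<Delta>)"
proof -
  interpret prob_space "exponential_law l" by (rule prob_space_exponential_density) fact
  have "{s. holding_steps \<Delta> l s = g}
      = {s. g - 1 < holding_steps \<Delta> l s} - {s. g < holding_steps \<Delta> l s}"
    using assms(4) by auto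
  also have "measure (exponential_law l) \<dots> = (1 - l * \<Delta>) ^ (g - 1) - (1 - l * \<Delta>) ^ g"
    by (subst finite_measure_Diff) (auto simp: holding_steps_tail[OF assms(1-3)])
  also have "\<dots> = (1 - l * \<Delta>) ^ (g - 1) * (l * \<Delta>)"
    using assms(4) by (cases g) (auto simp: algebra_simps)
  finally show ?thesis .
qed

text \<open>
  The unit of time is asymptotic to \<open>\<Delta>\<close>, because the derivative of \<open>ln (1 - l * \<Delta>)\<close> at \<open>0\<close> is \<open>- l\<close>,
  and rounding changes the product by at most \<open>\<Delta>\<close>.
\<close>

lemma holding_steps_asymp:
  assumes "l > 0" "s > 0"
  shows "((\<lambda>\<Delta>. \<Delta> * real (holding_steps \<Delta> l s)) \<longlongrightarrow> s) (at_right 0)"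
proof -
  have "((\<lambda>\<Delta>. ln (1 - l * \<Delta>)) has_real_derivative - l) (at 0)"
    by (auto intro!: derivative_eq_intros)
  then have "((\<lambda>\<Delta>. ln (1 - l * \<Delta>) / \<Delta>) \<longlongrightarrow> - l) (at_right 0)"
    by (auto simp: DERIV_def intro: filterlim_mono at_le)
  then have "((\<lambda>\<Delta>. s / (- (ln (1 - l * \<Delta>) / \<Delta>) / l)) \<longlongrightarrow> s / (- (- l) / l)) (at_right 0)"
    by (intro tendsto_intros) (use assms in auto)
  then have low: "((\<lambda>\<Delta>. \<Delta> * (s / (- ln (1 - l * \<Delta>) / l))) \<longlongrightarrow> s) (at_right 0)"
    using assms by (simp add: field_simps)
  then have up: "((\<lambda>\<Delta>. \<Delta> * (s / (- ln (1 - l * \<Delta>) / l)) + \<Delta>) \<longlongrightarrow> s + 0) (at_right 0)"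
    by (intro tendsto_intros)
  have "\<forall>\<^sub>F \<Delta> in at_right 0. 0 < \<Delta> \<and> \<Delta> < 1 / l"
    using assms(1) by (subst eventually_at_right_field) (auto intro!: exI[of _ "1 / l"])
  then have bounds: "\<forall>\<^sub>F \<Delta> in at_right 0.
      \<Delta> * (s / (- ln (1 - l * \<Delta>) / l)) \<le> \<Delta> * real (holding_steps \<Delta> l s) \<and>
      \<Delta> * real (holding_steps \<Delta> l s) \<le> \<Delta> * (s / (- ln (1 - l * \<Delta>) / l)) + \<Delta>"
  proof eventually_elim
    case (elim \<Delta>)
    define q where "q = s / (- ln (1 - l * \<Delta>) / l)"
    have "l * \<Delta> < 1" using elim assms by (simp add: field_simps)
    then have "- ln (1 - l * \<Delta>) / l > 0" using elim assms by (simp add: divide_neg_pos)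
    then have "q > 0" unfolding q_def using assms(2) by (rule divide_pos_pos[rotated])
    then have "real (holding_steps \<Delta> l s) = of_int \<lceil>q\<rceil>"
      unfolding holding_steps_def q_def[symmetric] by linarith
    then have "q \<le> real (holding_steps \<Delta> l s)" "real (holding_steps \<Delta> l s) \<le> q + 1"
      by linarith+
    then show ?case
      using elim mult_left_mono[of q "real (holding_steps \<Delta> l s)" \<Delta>]
        mult_left_mono[of "real (holding_steps \<Delta> l s)" "q + 1" \<Delta>]
      unfolding q_def[symmetric] by (simp add: algebra_simps)
  qed
  show ?thesis
    by (rule tendsto_sandwich[OF _ _ low])
      (use up bounds in \<open>auto elim: eventually_mono\<close>)
qed

section \<open>Coupling the discrete chain to the jump chain and its holding times\<close>

lemma total_rate_le_sum:
  assumes "\<And>j. j \<in> {1..k} \<Longrightarrow> total_rate k c j > 0" "j \<in> {1..k}"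
  shows "total_rate k c j \<le> (\<Sum>j=1..k. total_rate k c j)"
  using assms by (intro member_le_sum) (auto intro: less_imp_le)

lemma measurable_nat_count_space_UNIV:
  assumes "f \<in> measurable M (count_space A)"
  shows "f \<in> measurable M (count_space UNIV)"
  using measurable_compose[OF assms, of "\<lambda>x. x" "count_space UNIV"] by simp

text \<open>
  The data of \<open>continuous_time_chain\<close> without \<open>R\<close>: they alone determine the coupled discrete chain and its
  law, and \<open>R\<close> enters only when its paths are compared with those of the coupled chain.
\<close>

locale jump_holding = prob_space N for N :: "'b measure" +
  fixes k :: nat and c :: "nat \<Rightarrow> nat \<Rightarrow> real" and i :: nat
    and J :: "nat \<Rightarrow> 'b \<Rightarrow> nat" and S :: "nat \<Rightarrow> 'b \<Rightarrow> real"
  assumes no_self_rate: "\<And>j. j \<in> {1..k} \<Longrightarrow> c j j = 0"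
    and rate_pos: "\<And>j. j \<in> {1..k} \<Longrightarrow> total_rate k c j > 0"
    and start: "i \<in> {1..k}"
    and jumps: "markov_chain N {1..k} (\<lambda>j. j) (\<lambda>j j'. c j j' / total_rate k c j) i J"
    and S_measurable [measurable]: "\<And>n. S n \<in> borel_measurable N"
    and holding: "\<And>n a. a \<in> {..n} \<rightarrow> {1..k} \<Longrightarrow>
           \<P>(\<omega> in N. \<forall>m\<le>n. J m \<omega> = a m) > 0 \<Longrightarrow>
           (let P = uniform_measure N {\<omega> \<in> space N. \<forall>m\<le>n. J m \<omega> = a m}
            in prob_space.indep_vars P (\<lambda>_. borel) S {..n} \<and>
               (\<forall>m\<le>n. distributed P lborel (S m)
                  (\<lambda>x. ennreal (exponential_density (total_rate k c (a m)) x))))"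
begin

lemma J_measurable: "J n \<in> measurable N (count_space {1..k})"
  using jumps by (simp add: markov_chain_def)

lemma J_measurable_UNIV [measurable]: "J n \<in> measurable N (count_space UNIV)"
  by (rule measurable_nat_count_space_UNIV[OF J_measurable])

lemma J_range: "\<omega> \<in> space N \<Longrightarrow> J n \<omega> \<in> {1..k}"
  using measurable_space[OF J_measurable] by simp

lemma jump_path_prob:
  assumes "a \<in> {..n} \<rightarrow> {1..k}"
  shows "prob {\<omega> \<in> space N. \<forall>m\<le>n. J m \<omega> = a m} =
    of_bool (a 0 = i) * (\<Prod>m<n. c (a m) (a (Suc m)) / total_rate k c (a m))"
  using markov_chain_path_prob[OF jumps inj_on_id2 start assms] .

text \<open>
  Given the jump path, the holding times are independent and exponential, so their joint law with the
  jump chain is explicit.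
\<close>

lemma joint_prob:
  assumes a: "a \<in> {..n} \<rightarrow> {1..k}" and B: "\<And>m. B m \<in> sets borel"
  shows "prob {\<omega> \<in> space N. \<forall>m\<le>n. J m \<omega> = a m \<and> S m \<omega> \<in> B m} =
    prob {\<omega> \<in> space N. \<forall>m\<le>n. J m \<omega> = a m} *
    (\<Prod>m\<le>n. measure (exponential_law (total_rate k c (a m))) (B m))"
proof -
  let ?A = "{\<omega> \<in> space N. \<forall>m\<le>n. J m \<omega> = a m}"
  let ?E = "{\<omega> \<in> space N. \<forall>m\<le>n. J m \<omega> = a m \<and> S m \<omega> \<in> B m}"
  have A: "?A \<in> events" by measurable
  show ?thesis
  proof (cases "prob ?A > 0")
    case True
    define P where "P = uniform_measure N ?A"
    have P: "prob_space P" unfolding P_def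
      using True by (intro prob_space_uniform_measure) (auto simp: emeasure_eq_measure)
    interpret P: prob_space P by fact
    have spP: "space P = space N" and setsP: "sets P = sets N" by (simp_all add: P_def)
    have ind: "P.indep_vars (\<lambda>_. borel) S {..n}"
      and dist: "\<And>m. m \<le> n \<Longrightarrow> distributed P lborel (S m)
          (\<lambda>x. ennreal (exponential_density (total_rate k c (a m)) x))"
      using holding[OF a True] unfolding P_def Let_def by auto
    have "?E = ?A \<inter> (\<Inter>m\<in>{..n}. S m -` B m \<inter> space P)" by (auto simp: spP)
    moreover have SB: "S m -` B m \<inter> space P \<in> sets P" for m
      using measurable_sets[OF S_measurable B, of m m] by (simp add: spP setsP)
    then have "(\<Inter>m\<in>{..n}. S m -` B m \<inter> space P) \<in> sets N"
      unfolding setsP[symmetric] by (intro sets.finite_INT) auto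
    ultimately have "prob ?E / prob ?A = measure P (\<Inter>m\<in>{..n}. S m -` B m \<inter> space P)"
      unfolding P_def using A True by (subst measure_uniform_measure) (auto simp: emeasure_eq_measure)
    also have "\<dots> = (\<Prod>m\<le>n. measure P (S m -` B m \<inter> space P))"
      by (rule P.indep_varsD_finite[OF ind]) (auto simp: B)
    also have "\<dots> = (\<Prod>m\<le>n. measure (exponential_law (total_rate k c (a m))) (B m))"
    proof (rule prod.cong[OF refl])
      fix m assume "m \<in> {..n}"
      then have d: "distributed P lborel (S m)
          (\<lambda>x. ennreal (exponential_density (total_rate k c (a m)) x))" using dist by simp
      have "measure (exponential_law (total_rate k c (a m))) (B m) = measure (distr P lborel (S m)) (B m)"
        using d by (simp add: distributed_def)
      also have "\<dots> = measure P (S m -` B m \<inter> space P)"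
        using B[of m] distributed_measurable[OF d] by (intro measure_distr) auto
      finally show "measure P (S m -` B m \<inter> space P) = measure (exponential_law (total_rate k c (a m))) (B m)"
        by simp
    qed
    finally have quot: "prob ?E / prob ?A = (\<Prod>m\<le>n. measure (exponential_law (total_rate k c (a m))) (B m))" .
    have "prob ?A \<noteq> 0" using True by linarith
    then have "prob ?E = (\<Prod>m\<le>n. measure (exponential_law (total_rate k c (a m))) (B m)) * prob ?A"
      by (rule nonzero_divide_eq_eq[THEN iffD1, OF _ quot])
    then show ?thesis by (rule trans[OF _ mult.commute])
  next
    case False
    have "prob ?E \<le> prob ?A" using A by (rule finite_measure_mono[rotated]) auto
    moreover have "prob ?A = 0" using False measure_nonneg[of N ?A] by linarith
    ultimately have "prob ?E = 0" using measure_nonneg[of N ?E] by linarith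
    then show ?thesis using \<open>prob ?A = 0\<close> by (simp only: mult_zero_left)
  qed
qed

lemma sum_over_jump_paths:
  assumes "E \<in> events"
  shows "prob E = (\<Sum>a\<in>PiE {..n} (\<lambda>_. {1..k}). prob (E \<inter> {\<omega> \<in> space N. \<forall>m\<le>n. J m \<omega> = a m}))"
proof -
  have "J n \<in> measurable N (count_space ((\<lambda>j. j) ` {1..k}))" for n
    using J_measurable by simp
  from sum_over_finite_paths[OF finite_measure_axioms _ inj_on_id2 this assms]
  show ?thesis by simp
qed

lemma prob_space_exponential_law: "j \<in> {1..k} \<Longrightarrow> prob_space (exponential_law (total_rate k c j))"
  by (rule prob_space_exponential_density[OF rate_pos])

lemma AE_jump_moves: "AE \<omega> in N. \<forall>m. J (Suc m) \<omega> \<noteq> J m \<omega>"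
proof (subst AE_all_countable, rule allI)
  fix m
  let ?E = "{\<omega> \<in> space N. J (Suc m) \<omega> = J m \<omega>}"
  have "{\<omega> \<in> space N. real (J (Suc m) \<omega>) = real (J m \<omega>)} \<in> events" by measurable
  then have E: "?E \<in> events" by simp
  have "prob (?E \<inter> {\<omega> \<in> space N. \<forall>l\<le>Suc m. J l \<omega> = a l}) = 0"
    if a: "a \<in> PiE {..Suc m} (\<lambda>_. {1..k})" for a
  proof (cases "a (Suc m) = a m")
    case True
    have "c (a m) (a m) = 0" using a no_self_rate[of "a m"] by (auto simp: PiE_iff)
    then have "prob {\<omega> \<in> space N. \<forall>l\<le>Suc m. J l \<omega> = a l} = 0"
      using a True by (subst jump_path_prob) (auto simp: PiE_def)
    moreover have "prob (?E \<inter> {\<omega> \<in> space N. \<forall>l\<le>Suc m. J l \<omega> = a l})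
        \<le> prob {\<omega> \<in> space N. \<forall>l\<le>Suc m. J l \<omega> = a l}"
      by (rule finite_measure_mono) auto
    ultimately show ?thesis 
      using measure_nonneg[of N "?E \<inter> {\<omega> \<in> space N. \<forall>l\<le>Suc m. J l \<omega> = a l}"] by linarith
  next
    case False
    then have "?E \<inter> {\<omega> \<in> space N. \<forall>l\<le>Suc m. J l \<omega> = a l} = {}" by auto
    then show ?thesis by (simp only: measure_empty)
  qed
  then have "prob ?E = 0" by (subst sum_over_jump_paths[OF E, of "Suc m"]) simp
  then show "AE \<omega> in N. J (Suc m) \<omega> \<noteq> J m \<omega>"
    using prob_Collect_eq_0[OF E] by simp
qed

lemma AE_holding_pos: "AE \<omega> in N. \<forall>m. 0 < S m \<omega>"
proof (subst AE_all_countable, rule allI)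
  fix m
  let ?E = "{\<omega> \<in> space N. \<not> 0 < S m \<omega>}"
  have E: "?E \<in> events" by measurable
  have "prob (?E \<inter> {\<omega> \<in> space N. \<forall>l\<le>m. J l \<omega> = a l}) = 0"
    if a: "a \<in> PiE {..m} (\<lambda>_. {1..k})" for a
  proof -
    have am: "a m \<in> {1..k}" using a by auto
    interpret X: prob_space "exponential_law (total_rate k c (a m))" by (rule prob_space_exponential_law[OF am])
    have "measure (exponential_law (total_rate k c (a m))) {..0} = 1 - measure (exponential_law (total_rate k c (a m))) {x. 0 < x}"
      by (subst X.prob_compl[symmetric]) (auto intro!: arg_cong[where f = "measure _"])
    also have "\<dots> = 0" using exponential_law_tail[OF rate_pos[OF am], of 0] by simp
    finally have zero: "measure (exponential_law (total_rate k c (a m))) {..0} = 0" .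
    have "?E \<inter> {\<omega> \<in> space N. \<forall>l\<le>m. J l \<omega> = a l} =
        {\<omega> \<in> space N. \<forall>l\<le>m. J l \<omega> = a l \<and> S l \<omega> \<in> (if l = m then {..0} else UNIV)}"
      by auto
    then show ?thesis
      using a zero by (simp only:, subst joint_prob) (auto simp: PiE_def intro!: prod_zero bexI[of _ m])
  qed
  then have "prob ?E = 0" by (subst sum_over_jump_paths[OF E, of m]) simp
  then show "AE \<omega> in N. 0 < S m \<omega>"
    using prob_Collect_eq_0[OF E] by simp
qed

text \<open>
  Each holding time is at most \<open>1\<close> with conditional probability at most \<open>\<theta> < 1\<close>, where \<open>\<theta>\<close> is the
  same for all levels because there are finitely many rates.  By conditional independence, \<open>n + 1\<close>
  consecutive holding times are all at most \<open>1\<close> with probability at most \<open>\<theta> ^ Suc n\<close>.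
\<close>

lemma AE_long_holding: "AE \<omega> in N. \<exists>m\<ge>q. 1 < S m \<omega>"
proof -
  define \<Lambda> where "\<Lambda> = (\<Sum>j=1..k. total_rate k c j)"
  define \<theta> where "\<theta> = 1 - exp (- \<Lambda>)"
  have rate_le: "total_rate k c j \<le> \<Lambda>" if "j \<in> {1..k}" for j
    unfolding \<Lambda>_def by (rule total_rate_le_sum[OF rate_pos that])
  have "\<Lambda> > 0" using rate_le[OF start] rate_pos[OF start] by linarith
  then have \<theta>: "0 \<le> \<theta>" "\<theta> < 1" by (auto simp: \<theta>_def)
  have short: "measure (exponential_law (total_rate k c j)) {..1} \<le> \<theta>" if j: "j \<in> {1..k}" for j
  proof -
    interpret X: prob_space "exponential_law (total_rate k c j)" by (rule prob_space_exponential_law[OF j])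
    have "measure (exponential_law (total_rate k c j)) {..1} = 1 - measure (exponential_law (total_rate k c j)) {x. 1 < x}"
      by (subst X.prob_compl[symmetric]) (auto intro!: arg_cong[where f = "measure _"])
    also have "\<dots> = 1 - exp (- total_rate k c j)" using exponential_law_tail[OF rate_pos[OF j], of 1] by simp
    also have "\<dots> \<le> \<theta>" using rate_le[OF j] by (simp add: \<theta>_def)
    finally show ?thesis .
  qed
  let ?E = "{\<omega> \<in> space N. \<not> (\<exists>m\<ge>q. 1 < S m \<omega>)}"
  have E: "?E \<in> events" by measurable
  have "prob ?E \<le> \<theta> ^ Suc n" for n
  proof -
    let ?F = "{\<omega> \<in> space N. \<forall>l\<in>{q..q+n}. S l \<omega> \<le> 1}"
    have F: "?F \<in> events" by measurable
    have path: "prob (?F \<inter> {\<omega> \<in> space N. \<forall>l\<le>q+n. J l \<omega> = a l})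
        \<le> prob {\<omega> \<in> space N. \<forall>l\<le>q+n. J l \<omega> = a l} * \<theta> ^ Suc n"
      if a: "a \<in> PiE {..q+n} (\<lambda>_. {1..k})" for a
    proof -
      have a': "a \<in> {..q+n} \<rightarrow> {1..k}" using a by (simp add: PiE_def)
      have "?F \<inter> {\<omega> \<in> space N. \<forall>l\<le>q+n. J l \<omega> = a l} =
          {\<omega> \<in> space N. \<forall>l\<le>q+n. J l \<omega> = a l \<and> S l \<omega> \<in> (if q \<le> l then {..1} else UNIV)}"
        by auto
      then have "prob (?F \<inter> {\<omega> \<in> space N. \<forall>l\<le>q+n. J l \<omega> = a l}) =
          prob {\<omega> \<in> space N. \<forall>l\<le>q+n. J l \<omega> = a l} *
          (\<Prod>l\<le>q+n. measure (exponential_law (total_rate k c (a l))) (if q \<le> l then {..1} else UNIV))"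
        by (simp only:) (rule joint_prob[OF a'], simp)
      also have "(\<Prod>l\<le>q+n. measure (exponential_law (total_rate k c (a l))) (if q \<le> l then {..1} else UNIV))
          \<le> (\<Prod>l\<le>q+n. if q \<le> l then \<theta> else 1)"
      proof (rule prod_mono)
        fix l assume "l \<in> {..q+n}"
        then have "a l \<in> {1..k}" using a' by auto
        then show "0 \<le> measure (exponential_law (total_rate k c (a l))) (if q \<le> l then {..1} else UNIV) \<and>
            measure (exponential_law (total_rate k c (a l))) (if q \<le> l then {..1} else UNIV) \<le> (if q \<le> l then \<theta> else 1)"
          using short[of "a l"] prob_space.prob_le_1[OF prob_space_exponential_law] by auto
      qed
      also have "(\<Prod>l\<le>q+n. if q \<le> l then \<theta> else 1) = \<theta> ^ Suc n"
      proof -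
        have "{..q+n} \<inter> {l. q \<le> l} = {q..q+n}" by auto
        then show ?thesis by (simp add: prod.If_cases)
      qed
      finally show ?thesis by (simp add: mult_left_mono)
    qed
    have "prob ?E \<le> prob ?F" by (rule finite_measure_mono[OF _ F]) (auto simp: not_less)
    also have "\<dots> \<le> (\<Sum>a\<in>PiE {..q+n} (\<lambda>_. {1..k}).
        prob {\<omega> \<in> space N. \<forall>l\<le>q+n. J l \<omega> = a l} * \<theta> ^ Suc n)"
      unfolding sum_over_jump_paths[OF F, of "q+n"] by (rule sum_mono[OF path])
    also have "\<dots> = \<theta> ^ Suc n"
    proof -
      have "(\<Sum>a\<in>PiE {..q+n} (\<lambda>_. {1..k}). prob {\<omega> \<in> space N. \<forall>l\<le>q+n. J l \<omega> = a l}) = 1"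
        using sum_over_jump_paths[OF sets.top, of "q+n"] prob_space
        by (simp add: Collect_conj_eq Int_absorb1 Int_absorb2 Int_assoc[symmetric])
      then show ?thesis by (simp only: sum_distrib_right[symmetric] mult_1_left)
    qed
    finally show ?thesis .
  qed
  moreover have "(\<lambda>n. \<theta> ^ Suc n) \<longlonglongrightarrow> 0"
    using LIMSEQ_power_zero[of \<theta>] \<theta> by (intro LIMSEQ_Suc) auto
  ultimately have "prob ?E \<le> 0"
    by (intro LIMSEQ_le_const) auto
  then have "prob ?E = 0" using measure_nonneg[of N ?E] by linarith
  then show ?thesis using prob_Collect_eq_0[OF E] by simp
qed

lemma AE_no_explosion: "AE \<omega> in N. \<forall>b. \<exists>n. b < (\<Sum>m<n. S m \<omega>)"
proof -
  have "AE \<omega> in N. \<forall>q. \<exists>m\<ge>q. 1 < S m \<omega>"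
    by (subst AE_all_countable) (use AE_long_holding in blast)
  then show ?thesis using AE_holding_pos
  proof eventually_elim
    case (elim \<omega>)
    have "\<exists>n. real K \<le> (\<Sum>m<n. S m \<omega>)" for K
    proof (induction K)
      case (Suc K)
      then obtain n where n: "real K \<le> (\<Sum>m<n. S m \<omega>)" by blast
      obtain m where m: "m \<ge> n" "1 < S m \<omega>" using elim(1) by blast
      have "(\<Sum>l<n. S l \<omega>) \<le> (\<Sum>l<m. S l \<omega>)"
        using m elim(2) by (intro sum_mono2) (auto intro: less_imp_le)
      then have "real (Suc K) \<le> (\<Sum>l<Suc m. S l \<omega>)" using n m by simp
      then show ?case by blast
    qed (auto intro: exI[of _ 0])
    then show ?case by (meson reals_Archimedean2 less_le_trans)
  qed
qed

text \<open>
  The rounding depends on \<open>\<Delta>\<close> and on the current level, while \<open>J\<close> and \<open>S\<close> are the same for all \<open>\<Delta>\<close>.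
\<close>

definition steps :: "real \<Rightarrow> 'b \<Rightarrow> nat \<Rightarrow> nat" where
  "steps \<Delta> \<omega> m = holding_steps \<Delta> (total_rate k c (J m \<omega>)) (S m \<omega>)"

definition coupled_chain :: "real \<Rightarrow> nat \<Rightarrow> 'b \<Rightarrow> nat" where
  "coupled_chain \<Delta> t \<omega> = J (run_index (steps \<Delta> \<omega>) t) \<omega>"

lemma steps_measurable [measurable]: "(\<lambda>\<omega>. steps \<Delta> \<omega> m) \<in> measurable N (count_space UNIV)"
  unfolding steps_def
  by (rule measurable_compose_countable[where g = "J m"]) measurable

lemma coupled_chain_measurable: "coupled_chain \<Delta> t \<in> measurable N (count_space {1..k})"
proof -
  have sum_iff: "t < (\<Sum>m\<le>n. steps \<Delta> \<omega> m) \<longleftrightarrow> real t < (\<Sum>m\<le>n. real (steps \<Delta> \<omega> m))" for \<omega> n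
    unfolding of_nat_sum[symmetric] of_nat_less_iff ..
  have "(\<lambda>\<omega>. run_index (steps \<Delta> \<omega>) t) \<in> measurable N (count_space UNIV)"
    unfolding run_index_def sum_iff by (intro measurable_Least) measurable
  then show ?thesis
    unfolding coupled_chain_def by (rule measurable_compose_countable[OF J_measurable])
qed

text \<open>
  Off the null set where \<open>J\<close> has two equal consecutive values, the event fixes the jump path \<open>a\<close>,
  the numbers of steps of the completed runs, and a lower bound for the current one.  A jump from \<open>a m\<close> after \<open>g m\<close> steps then contributes
  \<open>(1 - \<lambda> \<Delta>) ^ (g m - 1) * (\<lambda> \<Delta>) * (c (a m) (a (Suc m)) / \<lambda>)\<close>, in which \<open>\<lambda>\<close> cancels and leaves the
  product of the transition probabilities.
\<close>

lemma coupled_chain_path_prob: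
  assumes adm: "admissible_step k c \<Delta>" and b: "b \<in> {..T} \<rightarrow> {1..k}"
  shows "prob {\<omega> \<in> space N. \<forall>t\<le>T. coupled_chain \<Delta> t \<omega> = b t} =
    of_bool (b 0 = i) * (\<Prod>t<T. trans_prob k c \<Delta> (b t) (b (Suc t)))"
proof -
  have \<Delta>: "\<Delta> > 0" and rate1: "\<And>j. j \<in> {1..k} \<Longrightarrow> total_rate k c j * \<Delta> < 1"
    using adm by (auto simp: admissible_step_def)
  have "\<forall>t\<le>T. b t \<in> {1..k}" using b by auto
  from run_event_iff[OF this] obtain n a g r where
    a: "a \<in> {..n} \<rightarrow> {1..k}" "a 0 = b 0" "a n = b T"
    and g: "\<forall>m<n. g m \<ge> 1 \<and> a (Suc m) \<noteq> a m" "(\<Sum>m<n. g m) + r = T"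
    and iff: "\<forall>J G. (\<forall>m. G m \<ge> (1::nat)) \<longrightarrow> (\<forall>m. J (Suc m) \<noteq> J m) \<longrightarrow>
       (\<forall>t\<le>T. J (run_index G t) = b t) \<longleftrightarrow>
       (\<forall>m\<le>n. J m = a m) \<and> (\<forall>m<n. G m = g m) \<and> r < G n"
    and prod: "\<forall>p :: nat \<Rightarrow> nat \<Rightarrow> real. (\<Prod>t<T. p (b t) (b (Suc t))) =
       (\<Prod>m<n. p (a m) (a m) ^ (g m - 1) * p (a m) (a (Suc m))) * p (a n) (a n) ^ r"
    by - (elim exE conjE, rule that, assumption+)
  define B where "B m = (if m < n then {s. holding_steps \<Delta> (total_rate k c (a m)) s = g m}
    else {s. r < holding_steps \<Delta> (total_rate k c (a m)) s})" for m
  have B: "B m \<in> sets borel" for m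
  proof -
    have "B m = holding_steps \<Delta> (total_rate k c (a m)) -` (if m < n then {g m} else {r<..}) \<inter> space borel"
      by (auto simp: B_def)
    also have "\<dots> \<in> sets borel" by (rule measurable_sets[OF measurable_holding_steps]) simp
    finally show ?thesis .
  qed
  have "prob {\<omega> \<in> space N. \<forall>t\<le>T. coupled_chain \<Delta> t \<omega> = b t} =
      prob {\<omega> \<in> space N. \<forall>m\<le>n. J m \<omega> = a m \<and> S m \<omega> \<in> B m}"
  proof (rule finite_measure_eq_AE)
    have ge1: "\<forall>m. steps \<Delta> \<omega> m \<ge> 1" for \<omega> by (simp add: steps_def holding_steps_def)
    have event: "(\<forall>m\<le>n. J m \<omega> = a m) \<and> (\<forall>m<n. steps \<Delta> \<omega> m = g m) \<and> r < steps \<Delta> \<omega> n \<longleftrightarrow>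
        (\<forall>m\<le>n. J m \<omega> = a m \<and> S m \<omega> \<in> B m)" for \<omega>
      unfolding steps_def B_def by (auto simp: le_less)
    show "AE \<omega> in N. (\<omega> \<in> {\<omega> \<in> space N. \<forall>t\<le>T. coupled_chain \<Delta> t \<omega> = b t}) =
        (\<omega> \<in> {\<omega> \<in> space N. \<forall>m\<le>n. J m \<omega> = a m \<and> S m \<omega> \<in> B m})"
      using AE_jump_moves
    proof eventually_elim
      case (elim \<omega>)
      show ?case
        using iff[THEN spec, THEN spec, THEN mp, THEN mp, OF ge1 elim] event[of \<omega>]
        by (simp add: coupled_chain_def)
    qed
    show "{\<omega> \<in> space N. \<forall>t\<le>T. coupled_chain \<Delta> t \<omega> = b t} \<in> events"
      by (rule path_event_measurable[OF coupled_chain_measurable])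
    show "{\<omega> \<in> space N. \<forall>m\<le>n. J m \<omega> = a m \<and> S m \<omega> \<in> B m} \<in> events"
      using B by measurable
  qed
  also have "\<dots> = of_bool (a 0 = i) * (\<Prod>m<n. c (a m) (a (Suc m)) / total_rate k c (a m)) *
      (\<Prod>m\<le>n. measure (exponential_law (total_rate k c (a m))) (B m))"
    unfolding joint_prob[OF a(1) B] jump_path_prob[OF a(1)] ..
  also have "(\<Prod>m\<le>n. measure (exponential_law (total_rate k c (a m))) (B m)) =
      (\<Prod>m<n. measure (exponential_law (total_rate k c (a m))) (B m)) * measure (exponential_law (total_rate k c (a n))) (B n)"
    by (simp add: lessThan_Suc_atMost[symmetric])
  also have "measure (exponential_law (total_rate k c (a n))) (B n) = trans_prob k c \<Delta> (a n) (a n) ^ r"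
  proof -
    have "a n \<in> {1..k}" using a(1) by auto
    from holding_steps_tail[OF rate_pos[OF this] \<Delta> rate1[OF this]]
    show ?thesis by (simp add: B_def trans_prob_def)
  qed
  also have "of_bool (a 0 = i) * (\<Prod>m<n. c (a m) (a (Suc m)) / total_rate k c (a m)) *
      ((\<Prod>m<n. measure (exponential_law (total_rate k c (a m))) (B m)) * trans_prob k c \<Delta> (a n) (a n) ^ r) =
      of_bool (a 0 = i) * ((\<Prod>m<n. c (a m) (a (Suc m)) / total_rate k c (a m) *
        measure (exponential_law (total_rate k c (a m))) (B m)) * trans_prob k c \<Delta> (a n) (a n) ^ r)"
    unfolding prod.distrib by (simp only: mult.assoc)
  also have "(\<Prod>m<n. c (a m) (a (Suc m)) / total_rate k c (a m) *
        measure (exponential_law (total_rate k c (a m))) (B m)) =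
      (\<Prod>m<n. trans_prob k c \<Delta> (a m) (a m) ^ (g m - 1) * trans_prob k c \<Delta> (a m) (a (Suc m)))"
  proof (rule prod.cong[OF refl])
    fix m assume "m \<in> {..<n}"
    then have m: "m < n" "a m \<in> {1..k}" "g m \<ge> 1" "a m \<noteq> a (Suc m)" using a(1) g(1) by auto
    have "measure (exponential_law (total_rate k c (a m))) (B m) =
        (1 - total_rate k c (a m) * \<Delta>) ^ (g m - 1) * (total_rate k c (a m) * \<Delta>)"
      using m holding_steps_point[OF rate_pos[OF m(2)] \<Delta> rate1[OF m(2)] m(3)] by (simp add: B_def)
    then show "c (a m) (a (Suc m)) / total_rate k c (a m) * measure (exponential_law (total_rate k c (a m))) (B m) =
        trans_prob k c \<Delta> (a m) (a m) ^ (g m - 1) * trans_prob k c \<Delta> (a m) (a (Suc m))"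
      using m rate_pos[OF m(2)] by (simp add: trans_prob_def)
  qed
  also have "(\<Prod>m<n. trans_prob k c \<Delta> (a m) (a m) ^ (g m - 1) * trans_prob k c \<Delta> (a m) (a (Suc m)))
      * trans_prob k c \<Delta> (a n) (a n) ^ r = (\<Prod>t<T. trans_prob k c \<Delta> (b t) (b (Suc t)))"
    using prod by simp
  finally show ?thesis using a(2) by simp
qed

lemma AE_coupled_chain_tendsto:
  fixes y :: "nat \<Rightarrow> real" and R :: "real \<Rightarrow> 'b \<Rightarrow> real"
  assumes \<delta>: "\<And>j. \<delta> j > 0" "\<delta> \<longlonglongrightarrow> (0::real)"
    and R: "AE \<omega> in N. \<forall>n t. 0 \<le> t \<and> (\<Sum>m<n. S m \<omega>) \<le> t \<and> t < (\<Sum>m<Suc n. S m \<omega>) \<longrightarrow>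
           R t \<omega> = y (J n \<omega>)"
  shows "AE \<omega> in N. AE u in lborel. u \<ge> 0 \<longrightarrow>
    (\<lambda>j. y (coupled_chain (\<delta> j) (Suc (nat \<lfloor>u / \<delta> j\<rfloor>)) \<omega>)) \<longlonglongrightarrow> R u \<omega>"
  using R AE_holding_pos AE_no_explosion AE_space
proof eventually_elim
  case (elim \<omega>)
  have "filterlim \<delta> (at_right 0) sequentially"
    using \<delta> less_imp_neq[OF \<delta>(1), symmetric] by (auto simp: filterlim_at)
  then have steps_lim: "(\<lambda>j. \<delta> j * real (steps (\<delta> j) \<omega> m)) \<longlonglongrightarrow> S m \<omega>" for m
    unfolding steps_def
    using filterlim_compose[OF holding_steps_asymp[OF rate_pos[OF J_range]]] elim by blast
  let ?T = "\<lambda>n. \<Sum>m<n. S m \<omega>"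
  \<comment> \<open>At a jump time the coupled chain may still be in the previous run; jump times form a null set.\<close>
  have "AE u in lborel. u \<notin> range ?T"
    by (intro AE_not_in countable_imp_null_set_lborel) auto
  then show ?case
  proof (eventually_elim, intro impI)
    fix u :: real assume u: "u \<notin> range ?T" "u \<ge> 0"
    define n where "n = (LEAST n. u < ?T (Suc n))"
    obtain n0 where "u < ?T n0" using elim(3) by blast
    moreover from this have "n0 \<noteq> 0" using u(2) by (auto simp del: sum.lessThan_Suc intro: ccontr)
    ultimately have "u < ?T (Suc (n0 - 1))" by simp
    then have n: "u < ?T (Suc n)" unfolding n_def by (rule LeastI)
    have "?T n \<le> u"
    proof (cases n)
      case 0
      then show ?thesis using u(2) by simp
    next
      case (Suc l)
      then have "\<not> u < ?T (Suc l)" using not_less_Least[of l "\<lambda>n. u < ?T (Suc n)"] by (simp add: n_def)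
      then show ?thesis using Suc by simp
    qed
    moreover have "?T n \<noteq> u" using u(1) by blast
    ultimately have lt: "?T n < u" by simp
    have "R u \<omega> = y (J n \<omega>)" using elim(1) u(2) n lt by auto
    moreover have "\<forall>\<^sub>F j in sequentially. run_index (steps (\<delta> j) \<omega>) (Suc (nat \<lfloor>u / \<delta> j\<rfloor>)) = n"
      by (rule run_index_at_position[OF \<delta> steps_lim u(2) lt n])
    ultimately show "(\<lambda>j. y (coupled_chain (\<delta> j) (Suc (nat \<lfloor>u / \<delta> j\<rfloor>)) \<omega>)) \<longlonglongrightarrow> R u \<omega>"
      unfolding coupled_chain_def by (intro tendsto_eventually) (auto elim: eventually_mono)
  qed
qed

end

section \<open>Convergence\<close>

text \<open>
  The reciprocal of the sum of all rates is a threshold, since that sum dominates every single rate.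
\<close>

lemma eventually_admissible:
  assumes "k \<ge> 1"
    and rate: "\<And>j. j \<in> {1..k} \<Longrightarrow> total_rate k c j > 0"
    and nonneg: "\<And>i j. i \<in> {1..k} \<Longrightarrow> j \<in> {1..k} \<Longrightarrow> c i j \<ge> 0"
  obtains b where "b > 0" "\<And>\<Delta>. 0 < \<Delta> \<Longrightarrow> \<Delta> < b \<Longrightarrow> admissible_step k c \<Delta>"
proof
  define \<Lambda> where "\<Lambda> = (\<Sum>j=1..k. total_rate k c j)"
  have rate_le: "total_rate k c j \<le> \<Lambda>" if "j \<in> {1..k}" for j
    unfolding \<Lambda>_def by (rule total_rate_le_sum[OF rate that])
  have "\<Lambda> > 0" using rate_le[of 1] rate[of 1] assms(1) by auto
  then show "1 / \<Lambda> > 0" by simp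
  fix \<Delta> assume \<Delta>: "0 < \<Delta>" "\<Delta> < 1 / \<Lambda>"
  have small: "total_rate k c j * \<Delta> < 1" if "j \<in> {1..k}" for j
  proof -
    have "total_rate k c j * \<Delta> \<le> \<Lambda> * \<Delta>" using rate_le[OF that] \<Delta> by simp
    also have "\<Lambda> * \<Delta> < 1" using \<Delta> \<open>\<Lambda> > 0\<close> by (simp add: field_simps)
    finally show ?thesis .
  qed
  have "c i j * \<Delta> \<le> 1" if "i \<in> {1..k}" "j \<in> {1..k}" for i j
  proof -
    have "c i j \<le> total_rate k c i"
      unfolding total_rate_def using that nonneg by (intro member_le_sum) auto
    then have "c i j * \<Delta> \<le> total_rate k c i * \<Delta>" using \<Delta> by simp
    then show ?thesis using small[OF that(1)] by linarith
  qed
  then show "admissible_step k c \<Delta>" using \<Delta> small by (simp add: admissible_step_def)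
qed

theorem theorem5p1:
  fixes k :: nat and y :: "nat \<Rightarrow> real" and c :: "nat \<Rightarrow> nat \<Rightarrow> real" and i :: nat
    and M :: "real \<Rightarrow> 'a measure" and Y :: "real \<Rightarrow> nat \<Rightarrow> 'a \<Rightarrow> real"
    and N :: "'b measure" and R :: "real \<Rightarrow> 'b \<Rightarrow> real"
  assumes "k \<ge> 2"
    and "inj_on y {1..k}"
    and "\<And>i j. i \<in> {1..k} \<Longrightarrow> j \<in> {1..k} \<Longrightarrow> i \<noteq> j \<Longrightarrow> c i j \<ge> 0"
    and "\<And>i. i \<in> {1..k} \<Longrightarrow> c i i = 0"
    and "\<And>i. i \<in> {1..k} \<Longrightarrow> (\<Sum>l=1..k. c i l) > 0"
    and "i \<in> {1..k}"
    and "\<And>\<Delta>. admissible_step k c \<Delta> \<Longrightarrow>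
           markov_chain (M \<Delta>) {1..k} y (trans_prob k c \<Delta>) i (Y \<Delta>)"
    and "continuous_time_chain N k y c i R"
  shows "converges_in_distribution
           M (\<lambda>\<Delta>. interpolate \<Delta> (rescaled \<Delta> (Y \<Delta>)))
           N (\<lambda>t \<omega>. LBINT s:{0..t}. R s \<omega>)
           (at_right 0)"
proof -
  let ?W = "path_of (\<lambda>t \<omega>. LBINT s:{0..t}. R s \<omega>)"
  let ?Z = "\<lambda>\<Delta>. path_of (interpolate \<Delta> (rescaled \<Delta> (Y \<Delta>)))"
  let ?ucc = "borel_of ucc_topology"
  let ?seq = "PiM UNIV (\<lambda>_::nat. borel) :: (nat \<Rightarrow> real) measure"
  have N: "prob_space N"
    and R: "\<And>t. t \<ge> 0 \<Longrightarrow> R t \<in> measurable N (count_space (y ` {1..k}))"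
    and R_cont: "\<And>\<omega> t. \<omega> \<in> space N \<Longrightarrow> t \<ge> 0 \<Longrightarrow> continuous (at_right t) (\<lambda>s. R s \<omega>)"
    using assms(8) by (auto simp: continuous_time_chain_def)
  obtain J S where "markov_chain N {1..k} (\<lambda>j. j) (\<lambda>j j'. c j j' / total_rate k c j) i J"
    and "\<forall>n. S n \<in> borel_measurable N"
    and "\<forall>n a. a \<in> {..n} \<rightarrow> {1..k} \<longrightarrow>
           \<P>(\<omega> in N. \<forall>m\<le>n. J m \<omega> = a m) > 0 \<longrightarrow>
           (let P = uniform_measure N {\<omega> \<in> space N. \<forall>m\<le>n. J m \<omega> = a m}
            in prob_space.indep_vars P (\<lambda>_. borel) S {..n} \<and>
               (\<forall>m\<le>n. distributed P lborel (S m)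
                  (\<lambda>x. ennreal (exponential_density (total_rate k c (a m)) x))))"
    and RJ: "AE \<omega> in N. \<forall>n t. 0 \<le> t \<and> (\<Sum>m<n. S m \<omega>) \<le> t \<and> t < (\<Sum>m<Suc n. S m \<omega>) \<longrightarrow>
           R t \<omega> = y (J n \<omega>)"
    using assms(8) unfolding continuous_time_chain_def by (elim conjE exE) (rule that)
  then interpret jump_holding N k c i J S
    using N assms(4-6) unfolding jump_holding_def jump_holding_axioms_def total_rate_def by simp
  obtain b where b: "b > 0" and adm: "\<And>\<Delta>. 0 < \<Delta> \<Longrightarrow> \<Delta> < b \<Longrightarrow> admissible_step k c \<Delta>"
  proof (rule eventually_admissible[where k = k and c = c])
    show "c i j \<ge> 0" if "i \<in> {1..k}" "j \<in> {1..k}" for i j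
      using assms(3)[OF that] assms(4)[OF that(1)] by (cases "i = j") auto
  qed (use assms(1) rate_pos in auto)
  define C where "C = (\<Sum>j=1..k. \<bar>y j\<bar>)"
  have C: "\<bar>y j\<bar> \<le> C" if "j \<in> {1..k}" for j
    unfolding C_def using that by (intro member_le_sum) auto
  have W: "?W \<in> measurable N ?ucc"
    by (rule measurable_integral_path[OF R R_cont C])

  have Y_meas: "(\<lambda>\<omega> n. Y \<Delta> n \<omega>) \<in> measurable (M \<Delta>) ?seq" if "admissible_step k c \<Delta>" for \<Delta>
    using assms(7)[OF that] unfolding markov_chain_def
    by (intro measurable_sequence_of_finite_range) auto
  have V: "(\<lambda>\<omega>. y (coupled_chain \<Delta> n \<omega>)) \<in> measurable N (count_space (y ` {1..k}))" for \<Delta> n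
    by (rule measurable_compose[OF coupled_chain_measurable]) simp
  have V_meas: "(\<lambda>\<omega> n. y (coupled_chain \<Delta> n \<omega>)) \<in> measurable N ?seq" for \<Delta>
    by (rule measurable_sequence_of_finite_range[OF V])
  \<comment> \<open>From here on the discrete chain is replaced by its copy on the probability space of the limit.\<close>
  have same_law: "distr (M \<Delta>) ?seq (\<lambda>\<omega> n. Y \<Delta> n \<omega>) = distr N ?seq (\<lambda>\<omega> n. y (coupled_chain \<Delta> n \<omega>))"
    if ad: "admissible_step k c \<Delta>" for \<Delta>
  proof (rule distr_eq_of_path_probs[OF _ N _ assms(2) _ V])
    note mc = assms(7)[OF ad]
    show "prob_space (M \<Delta>)" "Y \<Delta> n \<in> measurable (M \<Delta>) (count_space (y ` {1..k}))" for n
      using mc by (auto simp: markov_chain_def)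
    fix n :: nat and a assume a: "a \<in> {..n} \<rightarrow> {1..k}"
    have "(\<forall>m\<le>n. y (coupled_chain \<Delta> m \<omega>) = y (a m)) \<longleftrightarrow> (\<forall>m\<le>n. coupled_chain \<Delta> m \<omega> = a m)"
      if "\<omega> \<in> space N" for \<omega>
      using a measurable_space[OF coupled_chain_measurable that] inj_on_eq_iff[OF assms(2)]
      by (auto simp: Pi_iff)
    then have "{\<omega> \<in> space N. \<forall>m\<le>n. y (coupled_chain \<Delta> m \<omega>) = y (a m)} =
        {\<omega> \<in> space N. \<forall>m\<le>n. coupled_chain \<Delta> m \<omega> = a m}" by blast
    then show "measure (M \<Delta>) {\<omega> \<in> space (M \<Delta>). \<forall>m\<le>n. Y \<Delta> m \<omega> = y (a m)} =
        prob {\<omega> \<in> space N. \<forall>m\<le>n. y (coupled_chain \<Delta> m \<omega>) = y (a m)}"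
      using markov_chain_path_prob[OF mc assms(2,6) a] coupled_chain_path_prob[OF ad a] by simp
  qed simp
  have Z_meas: "?Z \<Delta> \<in> measurable (M \<Delta>) ?ucc" if "admissible_step k c \<Delta>" "\<Delta> > 0" for \<Delta>
    using measurable_compose[OF Y_meas[OF that(1)] measurable_grid_path[OF that(2)]]
    by (simp add: path_of_interpolate[abs_def])
  show ?thesis
    unfolding converges_in_distribution_def weakly_converges_def
  proof (intro conjI allI impI W)
    show "\<forall>\<^sub>F \<Delta> in at_right 0. ?Z \<Delta> \<in> measurable (M \<Delta>) ?ucc"
      using b adm Z_meas by (subst eventually_at_right_field) auto
    fix \<phi> :: "(real \<Rightarrow> real) \<Rightarrow> real"
    assume "continuous_map ucc_topology euclideanreal \<phi> \<and> bounded (\<phi> ` topspace ucc_topology)"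
    then have \<phi>: "continuous_map ucc_topology euclideanreal \<phi>" and bdd: "bounded (\<phi> ` path_space)"
      by auto
    note \<phi>_meas = ucc_continuous_measurable[OF \<phi>]
    obtain K where K: "\<And>f. f \<in> path_space \<Longrightarrow> \<bar>\<phi> f\<bar> \<le> K"
      using bdd by (auto simp: bounded_iff)
    show "((\<lambda>\<Delta>. integral\<^sup>L (distr (M \<Delta>) ?ucc (?Z \<Delta>)) \<phi>) \<longlongrightarrow> integral\<^sup>L (distr N ?ucc ?W) \<phi>) (at_right 0)"
    proof (rule tendsto_at_right_sequentially[OF b])
      fix \<delta> :: "nat \<Rightarrow> real"
      assume \<delta>: "\<And>j. 0 < \<delta> j" "\<And>j. \<delta> j < b" "\<delta> \<longlonglongrightarrow> 0"
      let ?V = "\<lambda>j \<omega>. grid_path (\<delta> j) (\<lambda>n. y (coupled_chain (\<delta> j) n \<omega>))"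
      have coupled: "integral\<^sup>L (distr (M (\<delta> j)) ?ucc (?Z (\<delta> j))) \<phi> = (\<integral>\<omega>. \<phi> (?V j \<omega>) \<partial>N)" for j
      proof -
        note ad = adm[OF \<delta>(1,2)]
        have \<phi>g: "(\<lambda>x. \<phi> (grid_path (\<delta> j) x)) \<in> borel_measurable ?seq"
          by (rule measurable_compose[OF measurable_grid_path[OF \<delta>(1)] \<phi>_meas])
        have "integral\<^sup>L (distr (M (\<delta> j)) ?ucc (?Z (\<delta> j))) \<phi>
            = (\<integral>\<omega>. \<phi> (grid_path (\<delta> j) (\<lambda>n. Y (\<delta> j) n \<omega>)) \<partial>M (\<delta> j))"
          by (subst integral_distr[OF Z_meas[OF ad \<delta>(1)] \<phi>_meas]) (simp add: path_of_interpolate)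
        also have "\<dots> = (\<integral>x. \<phi> (grid_path (\<delta> j) x) \<partial>distr (M (\<delta> j)) ?seq (\<lambda>\<omega> n. Y (\<delta> j) n \<omega>))"
          by (rule integral_distr[OF Y_meas[OF ad] \<phi>g, symmetric])
        also have "\<dots> = (\<integral>\<omega>. \<phi> (?V j \<omega>) \<partial>N)"
          unfolding same_law[OF ad] by (rule integral_distr[OF V_meas \<phi>g])
        finally show ?thesis .
      qed
      have V_ucc: "?V j \<in> measurable N ?ucc" for j
        by (rule measurable_compose[OF V_meas measurable_grid_path[OF \<delta>(1)]])
      have "(\<lambda>j. \<integral>\<omega>. \<phi> (?V j \<omega>) \<partial>N) \<longlonglongrightarrow> (\<integral>\<omega>. \<phi> (?W \<omega>) \<partial>N)"
      proof (rule integral_dominated_convergence[where w = "\<lambda>_. K"])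
        show "(\<lambda>\<omega>. \<phi> (?W \<omega>)) \<in> borel_measurable N" "(\<lambda>\<omega>. \<phi> (?V j \<omega>)) \<in> borel_measurable N" for j
          using measurable_compose[OF W \<phi>_meas] measurable_compose[OF V_ucc \<phi>_meas] by auto
        show "AE \<omega> in N. norm (\<phi> (?V j \<omega>)) \<le> K" for j
          using K grid_path_in_path_space[OF \<delta>(1)] by simp
        show "AE \<omega> in N. (\<lambda>j. \<phi> (?V j \<omega>)) \<longlonglongrightarrow> \<phi> (?W \<omega>)"
          using AE_coupled_chain_tendsto[OF \<delta>(1,3) RJ] AE_space
        proof eventually_elim
          case (elim \<omega>)
          have "limitin ucc_topology (\<lambda>j. ?V j \<omega>) (\<lambda>t\<in>{0..}. LBINT s:{0..t}. R s \<omega>) sequentially"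
          proof (rule grid_paths_converge_to_integral[OF \<delta>(1,3) _ _ _ elim(1)])
            show "\<bar>y (coupled_chain (\<delta> j) n \<omega>)\<bar> \<le> C" for j n
              using measurable_space[OF coupled_chain_measurable elim(2)] by (intro C) simp
            show "\<bar>R t \<omega>\<bar> \<le> C" if "t \<ge> 0" for t
              using measurable_space[OF R[OF that] elim(2)] C by auto
            show "set_borel_measurable lborel {0..} (\<lambda>s. R s \<omega>)"
              by (rule right_continuous_set_borel_measurable) (rule R_cont[OF elim(2)])
          qed
          from continuous_map_limit[OF \<phi> this]
          show ?case by (simp add: comp_def path_of_def)
        qed
      qed simp
      then show "(\<lambda>j. integral\<^sup>L (distr (M (\<delta> j)) ?ucc (?Z (\<delta> j))) \<phi>) \<longlonglongrightarrow> integral\<^sup>L (distr N ?ucc ?W) \<phi>"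
        unfolding coupled by (simp add: integral_distr[OF W \<phi>_meas])
    qed
  qed
qed

end
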